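(* For every $d\ge3$, the coefficient of $t^{d-1}$ in $H_d(t)$ is the number of strong tournament score sequences on $d$ vertices. Moreover, for $d=1$ and for every $d\ge3$, the leading (highest nonzero) coefficient of the rational Ehrhart numerator $h^*_{\mathbb Z}(R_d;t)$ equals the number of strong tournament score sequences on $d$ vertices. The case $d=2$ is exceptional: $h^*_{\mathbb Z}(R_2;t)=1+t$, while no tournament on two vertices is strong.
   Context: $P_d=P_d(132,213)\subset\mathbb R^d$ is the convex hull of the points $(\pi_1,\ldots,\pi_d)$ over all permutations $\pi$ of $\{1,\ldots,d\}$ avoiding both patterns $132$ and $213$. The polynomial $H_d(t)$ is defined by $\sum_{m\ge0}|mP_d\cap\mathbb Z^d|t^m=H_d(t)/(1-t)^d$. $R_d$ is the (translated chain-poset permutahedron) polytope of all $a\in\mathbb R^d$ with $a_1\le\cdots\le a_d$, $\sum_{i=1}^d a_i=\binom d2$, $\sum_{i=1}^k a_i\ge\binom k2$ for $1\le k<d$. Its rational Ehrhart numerator $h^*_{\mathbb Z}(R_d;t)$ is defined by $\sum_{m\ge0}|mR_d\cap\mathbb Z^d|t^m=h^*_{\mathbb Z}(R_d;t)/(1-t^2)^d$. A tournament is an orientation of a complete graph; its score sequence is the list of its vertex outdegrees in nondecreasing order. A tournament is strong if every vertex can reach every other vertex by a directed path; the one-vertex tournament is strong. A strong tournament score sequence is a sequence that is the score sequence of some strong tournament; each sequence is counted once, regardless of how many tournaments realize it. *)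

theory Defs
  imports
    "HOL-Analysis.Analysis"
    "HOL-Library.Function_Algebras"
    "HOL-Combinatorics.Permutations"
    "HOL-Computational_Algebra.Computational_Algebra"
begin

text \<open>
  The dimension \<open>d\<close> is a value, so points of \<open>\<real>\<^sup>d\<close> are rendered as functions \<open>nat \<Rightarrow> real\<close> with
  coordinates \<open>x 1, \<dots>, x d\<close> that vanish outside \<open>{1..d}\<close>. The pointwise vector space structure
  below makes the library notion \<open>convex hull\<close> available for such points.
\<close>

instantiation "fun" :: (type, real_vector) real_vector
begin

definition scaleR_fun :: "real \<Rightarrow> ('a \<Rightarrow> 'b) \<Rightarrow> 'a \<Rightarrow> 'b" where
  "scaleR_fun c f = (\<lambda>x. c *\<^sub>R f x)"

instance
  by standard (auto simp: scaleR_fun_def fun_eq_iff scaleR_add_right scaleR_add_left)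

end

definition ehrhart_series :: "(nat \<Rightarrow> real) set \<Rightarrow> real fps" where
  "ehrhart_series P =
     Abs_fps (\<lambda>m. real (card {x \<in> (\<lambda>y. real m *\<^sub>R y) ` P. \<forall>i. x i \<in> \<int>}))"

text \<open>The pattern \<open>p\<close> is given in one-line notation.\<close>

definition contains_pattern :: "nat \<Rightarrow> (nat \<Rightarrow> nat) \<Rightarrow> nat list \<Rightarrow> bool" where
  "contains_pattern d \<pi> p \<longleftrightarrow>
     (\<exists>f. strict_mono_on {..<length p} f \<and> f ` {..<length p} \<subseteq> {1..d} \<and>
          (\<forall>a<length p. \<forall>b<length p. \<pi> (f a) < \<pi> (f b) \<longleftrightarrow> p ! a < p ! b))"

definition perm_point :: "nat \<Rightarrow> (nat \<Rightarrow> nat) \<Rightarrow> nat \<Rightarrow> real" where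
  "perm_point d \<pi> = (\<lambda>i. if i \<in> {1..d} then real (\<pi> i) else 0)"

definition P_132_213 :: "nat \<Rightarrow> (nat \<Rightarrow> real) set" where
  "P_132_213 d = convex hull
     (perm_point d ` {\<pi>. \<pi> permutes {1..d} \<and> \<not> contains_pattern d \<pi> [1, 3, 2]
                                         \<and> \<not> contains_pattern d \<pi> [2, 1, 3]})"

definition R_polytope :: "nat \<Rightarrow> (nat \<Rightarrow> real) set" where
  "R_polytope d = {a. (\<forall>i. i \<notin> {1..d} \<longrightarrow> a i = 0) \<and> mono_on {1..d} a \<and>
     (\<Sum>i=1..d. a i) = real (d choose 2) \<and>
     (\<forall>k. 1 \<le> k \<and> k < d \<longrightarrow> (\<Sum>i=1..k. a i) \<ge> real (k choose 2))}"

text \<open>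
  Multiplication by a power series with constant term 1 is injective, so there is at most one
  polynomial as described; that it exists is a property of the polytope.
\<close>

definition H_poly :: "nat \<Rightarrow> real poly" where
  "H_poly d = (THE h. ehrhart_series (P_132_213 d) = fps_of_poly h / (1 - fps_X) ^ d)"

definition hstar_R :: "nat \<Rightarrow> real poly" where
  "hstar_R d = (THE h. ehrhart_series (R_polytope d) = fps_of_poly h / (1 - fps_X ^ 2) ^ d)"

text \<open>An arc \<open>(u, v) \<in> T\<close> points from \<open>u\<close> to \<open>v\<close>. Note that \<open>asym\<close> includes irreflexivity.\<close>

definition tournament :: "'v set \<Rightarrow> ('v \<times> 'v) set \<Rightarrow> bool" where
  "tournament V T \<longleftrightarrow> finite V \<and> T \<subseteq> V \<times> V \<and> asym T \<and> total_on V T"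

definition strong_tournament :: "'v set \<Rightarrow> ('v \<times> 'v) set \<Rightarrow> bool" where
  "strong_tournament V T \<longleftrightarrow> tournament V T \<and> V \<noteq> {} \<and> (\<forall>u\<in>V. \<forall>v\<in>V. (u, v) \<in> T\<^sup>*)"

definition score_sequence :: "'v set \<Rightarrow> ('v \<times> 'v) set \<Rightarrow> nat list" where
  "score_sequence V T =
     sorted_list_of_multiset (image_mset (\<lambda>v. card {w \<in> V. (v, w) \<in> T}) (mset_set V))"

definition strong_score_sequences :: "nat \<Rightarrow> nat list set" where
  "strong_score_sequences d = {score_sequence {1..d} T | T. strong_tournament {1..d} T}"

end

(*
  Write a point of either polytope through the excesses u_k of its partial sums over those of the
  extreme sequence, so u_0 = u_d = 0. With lap u k = 2 u_k - u_(k-1) - u_(k+1), both polytopes become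
  {u >= 0, lap u <= c} for 0 < k < d, with c = 1 for R_d and c = 2 for P_d(132,213), and strong score
  sequences become the integer u with u >= 1 and lap u <= 1 (Landau).

  For an arbitrary integer right-hand side b put
    f(b) = sum over u of prod over k of ([u_k >= 0] - [lap u k > b_k]).
  This sum is finite, and by the maximum principle it counts {u >= 0, lap u <= b} for b >= 0, and
  {u >= 1, lap u < -b} up to the sign (-1)^(d-1) for b < 0. Translating u by the unit vector e_k gives
  f(b) - f(b - lap e_k) = f(b restricted to k' < k) f(b restricted to k' > k), so by induction on d the
  function m -> f(b + 2 m) is a polynomial of degree < d, also at negative m. This yields rationality of
  the series and, by evaluation at m = -1, their top coefficients: f(-2) counts strong score sequences
  up to sign, and f(-1) = 0.
*)

theory Submission
  imports Defs
begin

section \<open>Signed lattice point counts\<close>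

text \<open>The factor [u_k >= 0] - [lap u k > b_k] is 1 if both constraints hold, -1 if both fail
  and 0 otherwise; so one sum covers both signs of b, and reciprocity becomes an evaluation. General
  b is unavoidable: unit translations lead from one constant b to another through non-constant b of
  mixed sign. The step 2 in m comes from integrality: the parabola (k - l) (r - k) has lap equal to
  2, so subtracting it from u matches lowering b by 2, whereas half of it need not be integral.
  Hence P_d, with c = 2, has a polynomial count, while R_d, with c = 1, has one polynomial for even
  and one for odd m, which explains (1 - t^2)^d. The m-th dilate of P_d and the (2m)-th dilate of
  R_d have equally many lattice points, so H_d is the even part of the numerator of R_d; f(-1) = 0
  removes the odd coefficient that would lie above its top. The inequalities for P_d need a vertex
  analysis: at a vertex every k has u_k = 0 or lap u k = 2, so u is a chain of parabolic arches
  between zeros, and each arch is a run of consecutive increasing values of a permutation.\<close>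

definition lap :: "(nat \<Rightarrow> 'a::ring_1) \<Rightarrow> nat \<Rightarrow> 'a" where
  "lap u k = 2 * u k - u (k - 1) - u (k + 1)"

text \<open>Zero boundary values at \<open>l\<close> and \<open>r\<close>; the values beyond are
  fixed only to make functions on the interval unique. Constraints are imposed for
  \<open>l < k < r\<close>, so the truncated \<open>k - 1\<close> in \<open>lap\<close> is
  harmless.\<close>

definition interior_funs :: "nat \<Rightarrow> nat \<Rightarrow> (nat \<Rightarrow> 'a::zero) set" where
  "interior_funs l r = {u. \<forall>k. k \<notin> {l<..<r} \<longrightarrow> u k = 0}"

definition bump :: "nat \<Rightarrow> nat \<Rightarrow> 'a::zero_neq_one" where
  "bump k j = of_bool (j = k)"

definition term_at :: "(nat \<Rightarrow> int) \<Rightarrow> (nat \<Rightarrow> int) \<Rightarrow> nat \<Rightarrow> int" where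
  "term_at b u k = of_bool (0 \<le> u k) - of_bool (b k < lap u k)"

definition sterm :: "nat \<Rightarrow> nat \<Rightarrow> (nat \<Rightarrow> int) \<Rightarrow> (nat \<Rightarrow> int) \<Rightarrow> int" where
  "sterm l r b u = (\<Prod>k\<in>{l<..<r}. term_at b u k)"

text \<open>Restricting to the support keeps the sum below finite; a sum over all of
  \<open>interior_funs l r\<close> would in general have an infinite index set and be 0 by
  convention.\<close>

definition ssupp :: "nat \<Rightarrow> nat \<Rightarrow> (nat \<Rightarrow> int) \<Rightarrow> (nat \<Rightarrow> int) set" where
  "ssupp l r b = {u \<in> interior_funs l r. sterm l r b u \<noteq> 0}"

definition signed_count :: "nat \<Rightarrow> nat \<Rightarrow> (nat \<Rightarrow> int) \<Rightarrow> int" where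
  "signed_count l r b = (\<Sum>u\<in>ssupp l r b. sterm l r b u)"

section \<open>Discrete maximum principle and finiteness of the support\<close>

text \<open>A positive maximum cannot sit on the boundary, where \<open>u\<close> is 0, and at an
  interior maximum neither neighbour is larger.\<close>

lemma interior_max:
  fixes u :: "nat \<Rightarrow> 'a::linordered_idom"
  assumes u: "u \<in> interior_funs l r" and j: "u j > 0"
  obtains k where "k \<in> {l<..<r}" "u j \<le> u k" "0 < u k" "0 \<le> lap u k"
proof -
  have jin: "j \<in> {l<..<r}" using u j by (force simp: interior_funs_def)
  define M where "M = Max (u ` {l<..<r})"
  have "M \<in> u ` {l<..<r}" unfolding M_def using jin by (intro Max_in) auto
  then obtain k where k: "k \<in> {l<..<r}" "M = u k" by auto
  have le: "u i \<le> u k" if "i \<in> {l<..<r}" for i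
    using that k(2) by (simp add: M_def flip: k(2))
  have pos: "0 < u k" using le[OF jin] j by simp
  have all: "u i \<le> u k" for i
  proof (cases "i \<in> {l<..<r}")
    case False
    then have "u i = 0" using u unfolding interior_funs_def by blast
    then show ?thesis using pos by simp
  qed (use le in auto)
  have "0 \<le> lap u k" unfolding lap_def using all[of "k-1"] all[of "k+1"] by (smt (verit) add_mono mult_2 diff_ge_0_iff_ge diff_diff_eq)
  with k pos le[OF jin] that show ?thesis by blast
qed

lemma interior_min:
  fixes u :: "nat \<Rightarrow> 'a::linordered_idom"
  assumes u: "u \<in> interior_funs l r" and j: "u j < 0"
  obtains k where "k \<in> {l<..<r}" "u k \<le> u j" "u k < 0" "lap u k \<le> 0"
proof -
  have "(\<lambda>i. - u i) \<in> interior_funs l r" "- u j > 0" using u j by (auto simp: interior_funs_def)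
  from interior_max[OF this] obtain k where
    "k \<in> {l<..<r}" "- u j \<le> - u k" "0 < - u k" "0 \<le> lap (\<lambda>i. - u i) k" by blast
  moreover have "lap (\<lambda>i. - u i) k = - lap u k" by (simp add: lap_def)
  ultimately show ?thesis using that by simp
qed

text \<open>The solution of \<open>lap u = 2\<close> with zero boundary values. It serves as the
  barrier in the bounds below and later as the translation that shifts \<open>b\<close> by exactly
  2.\<close>

definition parab :: "nat \<Rightarrow> nat \<Rightarrow> nat \<Rightarrow> int" where
  "parab l r k = (if k \<in> {l<..<r} then (int k - int l) * (int r - int k) else 0)"

lemma parab_interior: "parab l r \<in> interior_funs l r"
  by (simp add: parab_def interior_funs_def)

lemma parab_nonneg: "0 \<le> parab l r k"
  by (auto simp: parab_def)

lemma lap_parab: assumes "k \<in> {l<..<r}" shows "lap (parab l r) k = 2"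
proof -
  have *: "parab l r j = (int j - int l) * (int r - int j)" if "j \<in> {k-1,k,k+1}" for j
    using that assms by (auto simp: parab_def)
  have "int (k - 1) = int k - 1" using assms by auto
  then show ?thesis unfolding lap_def
    by (simp add: *) (simp add: algebra_simps)
qed

lemma sterm_nonzero_iff:
  "sterm l r b u \<noteq> 0 \<longleftrightarrow> (\<forall>k\<in>{l<..<r}. 0 \<le> u k \<longleftrightarrow> lap u k \<le> b k)"
  by (auto simp: sterm_def term_at_def not_less split: if_splits)

text \<open>Comparison with the barrier \<open>B * parab l r\<close>: if \<open>u\<close> exceeds it
  somewhere, the difference has a positive interior maximum, where \<open>lap u\<close> is at least
  \<open>2 * B\<close>, hence above \<open>b\<close>, although \<open>u\<close> is nonnegative; the
  term would then be 0. The lower bound is the mirror image.\<close>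

lemma ssupp_bound:
  assumes u: "u \<in> ssupp l r b" and B: "0 < B" "\<And>k. k \<in> {l<..<r} \<Longrightarrow> \<bar>b k\<bar> \<le> B"
  shows "\<bar>u j\<bar> \<le> B * parab l r j"
proof -
  have *: "0 \<le> u k \<longleftrightarrow> lap u k \<le> b k" if "k \<in> {l<..<r}" for k
    using u that unfolding ssupp_def mem_Collect_eq sterm_nonzero_iff by auto
  have uV: "u \<in> interior_funs l r" using u by (simp add: ssupp_def)
  have "u j \<le> B * parab l r j"
  proof (rule ccontr)
    assume "\<not> ?thesis"
    then have pos: "u j - B * parab l r j > 0" by simp
    have V: "(\<lambda>i. u i - B * parab l r i) \<in> interior_funs l r"
      using uV parab_interior[of l r] by (simp add: interior_funs_def)
    obtain k where k: "k \<in> {l<..<r}" "0 < u k - B * parab l r k"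
      "0 \<le> lap (\<lambda>i. u i - B * parab l r i) k" by (rule interior_max[OF V pos])
    have "lap (\<lambda>i. u i - B * parab l r i) k = lap u k - B * lap (parab l r) k"
      by (simp add: lap_def algebra_simps)
    then have "lap u k \<ge> 2 * B" using k lap_parab[OF k(1)] by simp
    moreover have "0 \<le> u k" using k(2) B(1) parab_nonneg[of l r k]
      by (smt (verit) mult_nonneg_nonneg)
    ultimately show False using *[OF k(1)] B(2)[OF k(1)] B(1) by linarith
  qed
  moreover have "- (B * parab l r j) \<le> u j"
  proof (rule ccontr)
    assume "\<not> ?thesis"
    then have pos: "u j + B * parab l r j < 0" by simp
    have V: "(\<lambda>i. u i + B * parab l r i) \<in> interior_funs l r"
      using uV parab_interior[of l r] by (simp add: interior_funs_def)
    obtain k where k: "k \<in> {l<..<r}" "u k + B * parab l r k < 0"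
      "lap (\<lambda>i. u i + B * parab l r i) k \<le> 0" by (rule interior_min[OF V pos])
    have "lap (\<lambda>i. u i + B * parab l r i) k = lap u k + B * lap (parab l r) k"
      by (simp add: lap_def algebra_simps)
    then have "lap u k \<le> - 2 * B" using k lap_parab[OF k(1)] by simp
    moreover have "u k < 0" using k(2) B(1) parab_nonneg[of l r k]
      by (smt (verit) mult_nonneg_nonneg)
    ultimately show False using *[OF k(1)] B(2)[OF k(1)] B(1) by linarith
  qed
  ultimately show ?thesis by linarith
qed

lemma finite_bounded_interior_funs:
  "finite {u \<in> interior_funs l r. \<forall>k. \<bar>u k\<bar> \<le> (B k :: int)}"
proof -
  have "{u \<in> interior_funs l r. \<forall>k. \<bar>u k\<bar> \<le> B k}
      \<subseteq> {u. \<forall>k. (k \<in> {l<..<r} \<longrightarrow> u k \<in> (\<Union>i\<in>{l<..<r}. {- B i..B i})) \<and> (k \<notin> {l<..<r} \<longrightarrow> u k = 0)}"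
    by (force simp: interior_funs_def abs_le_iff)
  then show ?thesis
    by (rule finite_subset) (rule finite_set_of_finite_funs; simp)
qed

lemma finite_ssupp: "finite (ssupp l r b)"
proof -
  define B where "B = 1 + (\<Sum>k\<in>{l<..<r}. \<bar>b k\<bar>)"
  have "\<bar>b k\<bar> \<le> B" if "k \<in> {l<..<r}" for k
    unfolding B_def using member_le_sum[OF that, of "\<lambda>k. \<bar>b k\<bar>"] by simp
  moreover have "0 < B" unfolding B_def by (simp add: sum_nonneg add_pos_nonneg)
  ultimately have "ssupp l r b \<subseteq> {u \<in> interior_funs l r. \<forall>k. \<bar>u k\<bar> \<le> B * parab l r k}"
    using ssupp_bound by (auto simp: ssupp_def)
  then show ?thesis by (rule finite_subset) (rule finite_bounded_interior_funs)
qed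

lemma signed_count_eq_sum:
  assumes "finite T" "ssupp l r b \<subseteq> T" "T \<subseteq> interior_funs l r"
  shows "signed_count l r b = (\<Sum>u\<in>T. sterm l r b u)"
  unfolding signed_count_def
  by (rule sum.mono_neutral_left) (use assms in \<open>auto simp: ssupp_def\<close>)

text \<open>At a negative minimum \<open>lap u\<close> is at most 0 and so at most \<open>b\<close>;
  both indicators in \<open>term_at\<close> are then 0.\<close>

lemma ssupp_nonneg:
  assumes "u \<in> ssupp l r b" "\<And>k. k \<in> {l<..<r} \<Longrightarrow> 0 \<le> b k"
  shows "0 \<le> u j"
proof (rule ccontr)
  assume "\<not> 0 \<le> u j"
  then have neg: "u j < 0" by simp
  have V: "u \<in> interior_funs l r" using assms by (simp add: ssupp_def)
  obtain k where "k \<in> {l<..<r}" "u k < 0" "lap u k \<le> 0"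
    by (rule interior_min[OF V neg])
  with assms(1) assms(2)[of k] show False
    unfolding ssupp_def mem_Collect_eq sterm_nonzero_iff by force
qed

lemma ssupp_neg:
  assumes "u \<in> ssupp l r b" "\<And>k. k \<in> {l<..<r} \<Longrightarrow> b k < 0" and j: "j \<in> {l<..<r}"
  shows "u j < 0"
proof (rule ccontr)
  assume "\<not> u j < 0"
  have uV: "u \<in> interior_funs l r" using assms by (simp add: ssupp_def)
  have *: "0 \<le> u k \<longleftrightarrow> lap u k \<le> b k" if "k \<in> {l<..<r}" for k
    using assms that unfolding ssupp_def mem_Collect_eq sterm_nonzero_iff by auto
  show False
  proof (cases "\<exists>i. u i > 0")
    case True
    then obtain i where "u i > 0" ..
    then obtain k where "k \<in> {l<..<r}" "0 < u k" "0 \<le> lap u k"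
      by (rule interior_max[OF uV])
    with * assms(2)[of k] show False by force
  next
    \<comment> \<open>Without positive values, a zero at the interior point \<open>j\<close> is
      itself a maximum, so \<open>lap u j\<close> is nonnegative and exceeds \<open>b j\<close>;
      both indicators are then 1.\<close>
    case False
    then have "u i \<le> 0" for i by (simp add: not_less)
    moreover from this have "u j = 0" using \<open>\<not> u j < 0\<close> by (meson antisym_conv2)
    ultimately have "0 \<le> lap u j" unfolding lap_def by (smt (verit))
    with * assms(2) j \<open>u j = 0\<close> show False by force
  qed
qed

lemma signed_count_nonneg:
  assumes "\<And>k. k \<in> {l<..<r} \<Longrightarrow> 0 \<le> b k"
  shows "signed_count l r b =
    int (card {u \<in> interior_funs l r. \<forall>k\<in>{l<..<r}. 0 \<le> u k \<and> lap u k \<le> b k})"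
proof -
  have eq: "ssupp l r b = {u \<in> interior_funs l r. \<forall>k\<in>{l<..<r}. 0 \<le> u k \<and> lap u k \<le> b k}"
    (is "_ = ?S")
  proof (intro set_eqI iffI)
    fix u assume u: "u \<in> ssupp l r b"
    then have "0 \<le> u k" for k by (rule ssupp_nonneg) (rule assms)
    with u show "u \<in> ?S" unfolding ssupp_def mem_Collect_eq sterm_nonzero_iff by auto
  next
    fix u assume "u \<in> ?S"
    then show "u \<in> ssupp l r b" unfolding ssupp_def mem_Collect_eq sterm_nonzero_iff by auto
  qed
  have "sterm l r b u = 1" if "u \<in> ?S" for u
    unfolding sterm_def by (rule prod.neutral) (use that in \<open>auto simp: term_at_def\<close>)
  then have "(\<Sum>u\<in>?S. sterm l r b u) = (\<Sum>u\<in>?S. 1)" by (rule sum.cong[OF refl])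
  then show ?thesis by (simp add: signed_count_def eq)
qed

text \<open>Reciprocity: on the support every one of the \<open>r - l - 1\<close> factors is -1, and
  negating \<open>u\<close> turns the violated constraints \<open>u k < 0\<close> and
  \<open>b k < lap u k\<close> into the strict ones counted here.\<close>

lemma signed_count_neg:
  assumes "\<And>k. k \<in> {l<..<r} \<Longrightarrow> b k < 0"
  shows "signed_count l r b = (- 1) ^ (r - l - 1) *
    int (card {u \<in> interior_funs l r. \<forall>k\<in>{l<..<r}. 0 < u k \<and> lap u k < - b k})"
proof -
  let ?S = "{u \<in> interior_funs l r. \<forall>k\<in>{l<..<r}. 0 < u k \<and> lap u k < - b k}"
  have lapneg: "lap (\<lambda>i. - u i) k = - lap u k" for u :: "nat \<Rightarrow> int" and k by (simp add: lap_def)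
  have sub: "u k < 0 \<and> b k < lap u k" if "u \<in> ssupp l r b" "k \<in> {l<..<r}" for u k
  proof -
    have "u k < 0" by (rule ssupp_neg[OF that(1) assms that(2)])
    with that show ?thesis unfolding ssupp_def mem_Collect_eq sterm_nonzero_iff
      by (meson not_less)
  qed
  have bij: "bij_betw (\<lambda>u i. - u i) (ssupp l r b) ?S"
  proof (rule bij_betw_byWitness[where f' = "\<lambda>u i. - u i"])
    show "(\<lambda>u i. - u i) ` ssupp l r b \<subseteq> ?S"
    proof (rule image_subsetI)
      fix u assume u: "u \<in> ssupp l r b"
      then have "u \<in> interior_funs l r" by (simp add: ssupp_def)
      with sub[OF u] show "(\<lambda>i. - u i) \<in> ?S"
        by (simp add: lapneg interior_funs_def)
    qed
    show "(\<lambda>u i. - u i) ` ?S \<subseteq> ssupp l r b"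
      unfolding ssupp_def sterm_nonzero_iff
      by (force simp: lapneg interior_funs_def)
  qed auto
  have "sterm l r b u = (- 1) ^ (r - l - 1)" if u: "u \<in> ssupp l r b" for u
  proof -
    have "sterm l r b u = (\<Prod>k\<in>{l<..<r}. - 1)"
      unfolding sterm_def
    proof (rule prod.cong[OF refl])
      fix k assume "k \<in> {l<..<r}"
      from sub[OF u this] show "term_at b u k = - 1" by (simp add: term_at_def)
    qed
    then show ?thesis by simp
  qed
  then have "signed_count l r b = (- 1) ^ (r - l - 1) * int (card (ssupp l r b))"
    by (simp add: signed_count_def)
  with bij_betw_same_card[OF bij] show ?thesis by simp
qed

section \<open>Change of the signed count under unit translations\<close>

lemma term_at_shift:
  "term_at (\<lambda>j. b j - lap (bump k) j) (\<lambda>j. u j - bump k j) j =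
    of_bool (bump k j \<le> u j) - of_bool (b j < lap u j)"
  by (simp add: term_at_def lap_def)

text \<open>The translation preserves every comparison of \<open>lap u\<close> with \<open>b\<close>
  and alters the sign test only at \<open>k\<close>, from \<open>0 \<le> u k\<close> to
  \<open>1 \<le> u k\<close>. The two terms therefore differ only where
  \<open>u k = 0\<close>.\<close>

lemma sterm_shift_diff:
  assumes "k \<in> {l<..<r}"
  shows "sterm l r b u - sterm l r (\<lambda>j. b j - lap (bump k) j) (\<lambda>j. u j - bump k j) =
    of_bool (u k = 0) * ((\<Prod>j\<in>{l<..<k}. term_at b u j) * (\<Prod>j\<in>{k<..<r}. term_at b u j))"
proof -
  have split: "(\<Prod>j\<in>{l<..<r}. f j) = f k * ((\<Prod>j\<in>{l<..<k}. f j) * (\<Prod>j\<in>{k<..<r}. f j))"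
    for f :: "nat \<Rightarrow> int"
  proof -
    have "{l<..<r} = insert k ({l<..<k} \<union> {k<..<r})" using assms by auto
    then have "(\<Prod>j\<in>{l<..<r}. f j) = f k * prod f ({l<..<k} \<union> {k<..<r})" by simp
    also have "prod f ({l<..<k} \<union> {k<..<r}) = prod f {l<..<k} * prod f {k<..<r}"
      by (rule prod.union_disjoint) auto
    finally show ?thesis .
  qed
  define Q where "Q = (\<Prod>j\<in>{l<..<k}. term_at b u j) * (\<Prod>j\<in>{k<..<r}. term_at b u j)"
  let ?t = "term_at (\<lambda>j. b j - lap (bump k) j) (\<lambda>j. u j - bump k j)"
  have "?t j = term_at b u j" if "j \<noteq> k" for j
    unfolding term_at_shift using that by (simp add: bump_def term_at_def)
  then have "(\<Prod>j\<in>{l<..<k}. ?t j) * (\<Prod>j\<in>{k<..<r}. ?t j) = Q"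
    unfolding Q_def by (intro arg_cong2[where f = "(*)"] prod.cong) auto
  moreover have "?t k = of_bool (1 \<le> u k) - of_bool (b k < lap u k)"
    unfolding term_at_shift by (simp add: bump_def)
  ultimately have "sterm l r (\<lambda>j. b j - lap (bump k) j) (\<lambda>j. u j - bump k j) =
      (of_bool (1 \<le> u k) - of_bool (b k < lap u k)) * Q"
    unfolding sterm_def split by simp
  moreover have "sterm l r b u = (of_bool (0 \<le> u k) - of_bool (b k < lap u k)) * Q"
    unfolding sterm_def split Q_def by (simp add: term_at_def)
  ultimately have "sterm l r b u - sterm l r (\<lambda>j. b j - lap (bump k) j) (\<lambda>j. u j - bump k j) =
      (of_bool (0 \<le> u k) - of_bool (1 \<le> u k)) * Q"
    by (simp only: left_diff_distrib)
  also have "of_bool (0 \<le> u k) - of_bool (1 \<le> u k) = (of_bool (u k = 0) :: int)"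
    by auto
  finally show ?thesis by (simp only: Q_def)
qed

lemma sterm_cong:
  assumes "\<And>j. l \<le> j \<Longrightarrow> j \<le> r \<Longrightarrow> u j = v j"
  shows "sterm l r b u = (\<Prod>j\<in>{l<..<r}. term_at b v j)"
  unfolding sterm_def
proof (rule prod.cong[OF refl])
  fix j assume "j \<in> {l<..<r}"
  moreover from this have "l \<le> j - 1" "j - 1 \<le> r" by auto
  ultimately show "term_at b u j = term_at b v j"
    using assms[of j] assms[of "j - 1"] assms[of "j + 1"] by (simp add: term_at_def lap_def)
qed

text \<open>A function with \<open>u k = 0\<close> is a pair of independent functions on the two
  sides of \<open>k\<close>, so the terms left over by \<open>sterm_shift_diff\<close> sum to a
  product.\<close>

lemma signed_count_diff:
  assumes k: "k \<in> {l<..<r}"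
  shows "signed_count l r b - signed_count l r (\<lambda>j. b j - lap (bump k) j) =
    signed_count l k b * signed_count k r b"
proof -
  define b' where "b' = (\<lambda>j. b j - lap (bump k) j)"
  define P where "P u = (\<Prod>j\<in>{l<..<k}. term_at b u j) * (\<Prod>j\<in>{k<..<r}. term_at b u j)" for u
  define J :: "(nat \<Rightarrow> int) \<times> (nat \<Rightarrow> int) \<Rightarrow> nat \<Rightarrow> int" where "J = (\<lambda>(v, w) j. v j + w j)"
  define S where "S = ssupp l k b \<times> ssupp k r b"
  \<comment> \<open>One finite index set for all the sums: the support for \<open>b\<close>, the
    support for \<open>b'\<close> translated by \<open>bump k\<close>, and all pairs glued at their
    common zero \<open>k\<close>.\<close>
  define T where "T = ssupp l r b \<union> (\<lambda>u j. u j + bump k j) ` ssupp l r b' \<union> J ` S"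
  have finS: "finite S" by (simp add: S_def finite_ssupp)
  have finT: "finite T" by (simp add: T_def finite_ssupp finS)
  have S_zero1: "v j = 0" if "(v, w) \<in> S" "j \<le> l \<or> k \<le> j" for v w j
    using that by (force simp: S_def ssupp_def interior_funs_def)
  have S_zero2: "w j = 0" if "(v, w) \<in> S" "j \<le> k \<or> r \<le> j" for v w j
    using that by (force simp: S_def ssupp_def interior_funs_def)
  have TV: "T \<subseteq> interior_funs l r"
  proof -
    have "J p \<in> interior_funs l r" if "p \<in> S" for p
    proof (cases p)
      case (Pair v w)
      have "v j = 0 \<and> w j = 0" if "j \<notin> {l<..<r}" for j
        using S_zero1[of v w j] S_zero2[of v w j] \<open>p \<in> S\<close> that k unfolding Pair by auto
      then show ?thesis unfolding Pair by (simp add: J_def interior_funs_def)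
    qed
    moreover have "(\<lambda>j. u j + bump k j) \<in> interior_funs l r" if "u \<in> ssupp l r b'" for u
      using that k by (auto simp: ssupp_def interior_funs_def bump_def)
    moreover have "ssupp l r b \<subseteq> interior_funs l r" by (auto simp: ssupp_def)
    ultimately show ?thesis unfolding T_def by blast
  qed
  have "signed_count l r b = (\<Sum>u\<in>T. sterm l r b u)"
    by (rule signed_count_eq_sum) (use finT TV in \<open>auto simp: T_def\<close>)
  moreover have "signed_count l r b' = (\<Sum>u\<in>T. sterm l r b' (\<lambda>j. u j - bump k j))"
  proof -
    have "signed_count l r b' = (\<Sum>u\<in>(\<lambda>u j. u j - bump k j) ` T. sterm l r b' u)"
    proof (rule signed_count_eq_sum)
      have "u \<in> (\<lambda>u j. u j - bump k j) ` T" if "u \<in> ssupp l r b'" for u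
        by (rule image_eqI[where x = "\<lambda>j. u j + bump k j"]) (use that in \<open>auto simp: T_def\<close>)
      then show "ssupp l r b' \<subseteq> (\<lambda>u j. u j - bump k j) ` T" by blast
      show "(\<lambda>u j. u j - bump k j) ` T \<subseteq> interior_funs l r"
        using TV k by (auto simp: interior_funs_def bump_def)
    qed (use finT in simp)
    moreover have "inj_on (\<lambda>u j. u j - bump k j :: int) T"
      by (auto simp: inj_on_def fun_eq_iff)
    ultimately show ?thesis by (simp add: sum.reindex)
  qed
  ultimately have "signed_count l r b - signed_count l r b' = (\<Sum>u\<in>T. of_bool (u k = 0) * P u)"
    unfolding b'_def P_def by (simp only: sterm_shift_diff[OF k] flip: sum_subtractf)
  also have "\<dots> = (\<Sum>u\<in>J ` S. of_bool (u k = 0) * P u)"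
  proof (rule sum.mono_neutral_right[OF finT])
    show "J ` S \<subseteq> T" by (simp add: T_def)
    show "\<forall>u\<in>T - J ` S. of_bool (u k = 0) * P u = 0"
    proof (rule ballI, rule ccontr)
      fix u assume u: "u \<in> T - J ` S" and "of_bool (u k = 0) * P u \<noteq> 0"
      then have "u k = 0" "P u \<noteq> 0" by (auto split: if_splits)
      define v where "v j = (if j \<le> k then u j else 0)" for j
      define w where "w j = (if k \<le> j then u j else 0)" for j
      have uV: "u \<in> interior_funs l r" using TV u by blast
      have "sterm l k b v = (\<Prod>j\<in>{l<..<k}. term_at b u j)"
        by (rule sterm_cong) (simp add: v_def)
      moreover have "v \<in> interior_funs l k"
        using uV \<open>u k = 0\<close> k by (auto simp: v_def interior_funs_def)
      moreover have "sterm k r b w = (\<Prod>j\<in>{k<..<r}. term_at b u j)"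
        by (rule sterm_cong) (simp add: w_def)
      moreover have "w \<in> interior_funs k r"
        using uV \<open>u k = 0\<close> k by (auto simp: w_def interior_funs_def)
      ultimately have "(v, w) \<in> S" using \<open>P u \<noteq> 0\<close> by (simp add: S_def ssupp_def P_def)
      moreover have "u = J (v, w)"
        using \<open>u k = 0\<close> by (auto simp: J_def v_def w_def fun_eq_iff)
      ultimately show False using u by blast
    qed
  qed
  also have "\<dots> = (\<Sum>p\<in>S. of_bool (J p k = 0) * P (J p))"
  proof (rule sum.reindex_cong[OF _ refl refl])
    show "inj_on J S"
    proof (rule inj_onI)
      fix p q assume "p \<in> S" "q \<in> S" "J p = J q"
      obtain v w v' w' where pq: "p = (v, w)" "q = (v', w')" by (cases p, cases q)
      have eq: "v j + w j = v' j + w' j" for j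
        using fun_cong[OF \<open>J p = J q\<close>, of j] by (simp add: J_def pq)
      have "v j = v' j \<and> w j = w' j" for j
        using eq[of j] S_zero1[of v w j] S_zero2[of v w j] S_zero1[of v' w' j] S_zero2[of v' w' j] \<open>p \<in> S\<close> \<open>q \<in> S\<close>
        unfolding pq by (cases "j \<le> k") auto
      then show "p = q" by (simp add: pq fun_eq_iff)
    qed
  qed
  also have "\<dots> = (\<Sum>(v, w)\<in>S. sterm l k b v * sterm k r b w)"
  proof (rule sum.cong[OF refl])
    fix p assume p: "p \<in> S"
    obtain v w where vw: "p = (v, w)" by (cases p)
    note z = S_zero1[OF p[unfolded vw]] S_zero2[OF p[unfolded vw]]
    have "sterm l k b v = (\<Prod>j\<in>{l<..<k}. term_at b (J p) j)"
      by (rule sterm_cong) (use z(2) in \<open>auto simp: J_def vw\<close>)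
    moreover have "sterm k r b w = (\<Prod>j\<in>{k<..<r}. term_at b (J p) j)"
      by (rule sterm_cong) (use z(1) in \<open>auto simp: J_def vw\<close>)
    moreover have "J p k = 0" using z(1)[of k] z(2)[of k] by (simp add: J_def vw)
    ultimately show "of_bool (J p k = 0) * P (J p) = (case p of (v, w) \<Rightarrow> sterm l k b v * sterm k r b w)"
      by (simp add: P_def vw)
  qed
  also have "\<dots> = signed_count l k b * signed_count k r b"
    by (simp add: S_def signed_count_def sum_product sum.cartesian_product)
  finally show ?thesis by (simp add: b'_def)
qed

lemma signed_count_cong:
  assumes "\<And>k. k \<in> {l<..<r} \<Longrightarrow> b k = c k"
  shows "signed_count l r b = signed_count l r c"
proof -
  have "sterm l r b = sterm l r c"
    using assms by (auto simp: sterm_def term_at_def fun_eq_iff intro!: prod.cong)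
  then show ?thesis by (simp add: signed_count_def ssupp_def)
qed

section \<open>Polynomiality and series numerators\<close>

text \<open>Polynomial functions of degree below \<open>n\<close> on all integers, encoded by
  iterated backward differences. Values at negative arguments stay accessible, and no rational
  coefficients arise.\<close>

primrec vanishing_diff :: "nat \<Rightarrow> (int \<Rightarrow> int) \<Rightarrow> bool" where
  "vanishing_diff 0 g \<longleftrightarrow> (\<forall>m. g m = 0)"
| "vanishing_diff (Suc n) g \<longleftrightarrow> vanishing_diff n (\<lambda>m. g m - g (m - 1))"

lemma vanishing_diff_shift: "vanishing_diff n g \<Longrightarrow> vanishing_diff n (\<lambda>m. g (m + c))"
proof (induction n arbitrary: g)
  case (Suc n)
  from Suc.IH[OF Suc.prems[unfolded vanishing_diff.simps]] show ?case
    by (simp add: algebra_simps)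
qed simp

lemma vanishing_diff_add:
  "vanishing_diff n f \<Longrightarrow> vanishing_diff n g \<Longrightarrow> vanishing_diff n (\<lambda>m. f m + g m)"
proof (induction n arbitrary: f g)
  case (Suc n)
  then have "vanishing_diff n (\<lambda>m. (f m - f (m - 1)) + (g m - g (m - 1)))" by simp
  then show ?case by (simp add: algebra_simps)
qed simp

lemma vanishing_diff_zero: "vanishing_diff n (\<lambda>m. 0)"
  by (induction n) auto

text \<open>Leibniz rule: the backward difference of \<open>f m * g m\<close> is that of
  \<open>f\<close> times \<open>g m\<close> plus \<open>f (m - 1)\<close> times that of
  \<open>g\<close>. If \<open>a\<close> or \<open>c\<close> is 0, the factor in question is constant
  and its summand disappears.\<close>

lemma vanishing_diff_mult:
  "vanishing_diff (Suc a) f \<Longrightarrow> vanishing_diff (Suc c) g \<Longrightarrow>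
    vanishing_diff (Suc (a + c)) (\<lambda>m. f m * g m)"
proof (induction "a + c" arbitrary: a c f g rule: less_induct)
  case less
  have "vanishing_diff (a + c) (\<lambda>m. (f m - f (m - 1)) * g m)"
  proof (cases a)
    case 0
    with less.prems have "f m - f (m - 1) = 0" for m by simp
    then show ?thesis by (simp add: vanishing_diff_zero del: right_minus_eq)
  next
    case (Suc a')
    with less.hyps[of a' c "\<lambda>m. f m - f (m - 1)" g] less.prems show ?thesis by simp
  qed
  moreover have "vanishing_diff (a + c) (\<lambda>m. f (m - 1) * (g m - g (m - 1)))"
  proof (cases c)
    case 0
    with less.prems have "g m - g (m - 1) = 0" for m by simp
    then show ?thesis by (simp add: vanishing_diff_zero del: right_minus_eq)
  next
    case (Suc c')
    with less.hyps[of a c' "\<lambda>m. f (m - 1)" "\<lambda>m. g m - g (m - 1)"] less.prems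
      vanishing_diff_shift[of "Suc a" f "- 1"] show ?thesis by simp
  qed
  ultimately have "vanishing_diff (a + c)
      (\<lambda>m. (f m - f (m - 1)) * g m + f (m - 1) * (g m - g (m - 1)))"
    by (rule vanishing_diff_add)
  then show ?case by (simp add: algebra_simps)
qed

lemma signed_count_empty: "signed_count l (Suc l) b = 1"
proof -
  have "{l<..<Suc l} = {}" by auto
  then have "interior_funs l (Suc l) = {\<lambda>_. 0 :: int}" by (auto simp: interior_funs_def)
  then have "ssupp l (Suc l) b = {\<lambda>_. 0}"
    using \<open>{l<..<Suc l} = {}\<close> by (auto simp: ssupp_def sterm_def)
  then show ?thesis using \<open>{l<..<Suc l} = {}\<close> by (simp add: signed_count_def sterm_def)
qed

text \<open>\<open>lap w\<close> is subtracted from \<open>b\<close> one unit vector at a time, and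
  each step changes the count by the product from \<open>signed_count_diff\<close>. The hypothesis
  \<open>prod\<close> is stated for all \<open>b\<close> because the right-hand side moves along
  with the steps.\<close>

lemma vanishing_diff_signed_count_sub_lap:
  fixes w :: "nat \<Rightarrow> int"
  assumes prod: "\<And>k b. k \<in> {l<..<r} \<Longrightarrow>
      vanishing_diff n (\<lambda>m. signed_count l k (\<lambda>j. b j + 2 * m) * signed_count k r (\<lambda>j. b j + 2 * m))"
    and w: "w \<in> interior_funs l r" "\<And>k. 0 \<le> w k"
  shows "vanishing_diff n
    (\<lambda>m. signed_count l r (\<lambda>j. b j + 2 * m) - signed_count l r (\<lambda>j. b j - lap w j + 2 * m))"
  using w
proof (induction "\<Sum>k\<in>{l<..<r}. nat (w k)" arbitrary: w b rule: less_induct)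
  case (less w b)
  show ?case
  proof (cases "\<exists>k. w k > 0")
    case False
    with less.prems(2) have "w k = 0" for k by (metis order.not_eq_order_implies_strict)
    then have "lap w j = 0" for j by (simp add: lap_def)
    then show ?thesis by (simp add: vanishing_diff_zero)
  next
    case True
    then obtain k where wk: "w k > 0" by blast
    then have k: "k \<in> {l<..<r}" using less.prems(1) by (force simp: interior_funs_def)
    define w' where "w' j = w j - bump k j" for j
    have "nat (w' k) < nat (w k)" using wk by (simp add: w'_def bump_def)
    then have sm: "(\<Sum>j\<in>{l<..<r}. nat (w' j)) < (\<Sum>j\<in>{l<..<r}. nat (w j))"
      using k by (intro sum_strict_mono_ex1) (auto simp: w'_def bump_def)
    have w'V: "w' \<in> interior_funs l r"
      using less.prems(1) k by (auto simp: w'_def interior_funs_def bump_def)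
    have w'0: "0 \<le> w' j" for j using less.prems(2) wk by (simp add: w'_def bump_def)
    define b' where "b' j = b j - lap (bump k) j" for j
    have eq: "b j - lap w j + 2 * m = b' j - lap w' j + 2 * m" for j m
      by (simp add: b'_def w'_def lap_def)
    have "vanishing_diff n (\<lambda>m. signed_count l r (\<lambda>j. b' j + 2 * m) -
        signed_count l r (\<lambda>j. b' j - lap w' j + 2 * m))"
      by (rule less.hyps[OF sm w'V w'0])
    moreover have "signed_count l r (\<lambda>j. b j + 2 * m) - signed_count l r (\<lambda>j. b' j + 2 * m) =
        signed_count l k (\<lambda>j. b j + 2 * m) * signed_count k r (\<lambda>j. b j + 2 * m)" for m
      using signed_count_diff[OF k, of "\<lambda>j. b j + 2 * m"] by (simp add: b'_def algebra_simps)
    then have "vanishing_diff n (\<lambda>m. signed_count l r (\<lambda>j. b j + 2 * m) -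
        signed_count l r (\<lambda>j. b' j + 2 * m))"
      using prod[OF k, of b] by simp
    ultimately have "vanishing_diff n (\<lambda>m. (signed_count l r (\<lambda>j. b j + 2 * m) -
        signed_count l r (\<lambda>j. b' j + 2 * m)) + (signed_count l r (\<lambda>j. b' j + 2 * m) -
        signed_count l r (\<lambda>j. b' j - lap w' j + 2 * m)))"
      by (rule vanishing_diff_add[rotated])
    then show ?thesis unfolding eq by simp
  qed
qed

text \<open>For \<open>w = parab l r\<close> the total shift of \<open>b\<close> is 2, which
  replaces \<open>m\<close> by \<open>m - 1\<close>, so the preceding lemma controls the backward
  difference itself. Its products have degree at most (k - l - 1) + (r - k - 1) = r - l - 2, one
  less than is claimed for the count.\<close>

lemma vanishing_diff_signed_count:
  "l < r \<Longrightarrow> vanishing_diff (r - l) (\<lambda>m. signed_count l r (\<lambda>j. b j + 2 * m))"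
proof (induction "r - l" arbitrary: l r b rule: less_induct)
  case (less l r b)
  obtain n where n: "r - l = Suc n" using less.prems by (cases "r - l") auto
  have "vanishing_diff n (\<lambda>m. signed_count l k (\<lambda>j. b j + 2 * m) * signed_count k r (\<lambda>j. b j + 2 * m))"
    if "k \<in> {l<..<r}" for k b
  proof -
    have "k - l = Suc (k - Suc l)" "r - k = Suc (r - Suc k)" using that by auto
    then obtain p q where pq: "k - l = Suc p" "r - k = Suc q" by blast
    then have "Suc (p + q) = n" using n that by auto
    moreover have "vanishing_diff (Suc p) (\<lambda>m. signed_count l k (\<lambda>j. b j + 2 * m))"
      "vanishing_diff (Suc q) (\<lambda>m. signed_count k r (\<lambda>j. b j + 2 * m))"
      unfolding pq[symmetric] using that by (auto intro!: less.hyps)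
    ultimately show ?thesis using vanishing_diff_mult by blast
  qed
  then have "vanishing_diff n (\<lambda>m. signed_count l r (\<lambda>j. b j + 2 * m) -
      signed_count l r (\<lambda>j. b j - lap (parab l r) j + 2 * m))"
    by (rule vanishing_diff_signed_count_sub_lap[OF _ parab_interior parab_nonneg])
  moreover have "signed_count l r (\<lambda>j. b j - lap (parab l r) j + 2 * m) =
      signed_count l r (\<lambda>j. b j + 2 * (m - 1))" for m
    by (rule signed_count_cong) (simp add: lap_parab)
  ultimately show ?case unfolding n by simp
qed

text \<open>Multiplication by 1 - X passes to the backward difference and leaves the constant
  \<open>g (- 1)\<close>, since the difference at 0 reaches back to -1. Of the leftovers of all
  rounds only the first, \<open>g (- 1)\<close> times (1 - X)^n, attains degree
  \<open>n\<close>.\<close>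

lemma fps_mult_vanishing_diff:
  assumes "vanishing_diff (Suc n) g"
  obtains h :: "real poly" where "degree h \<le> n" "coeff h n = (- 1) ^ n * real_of_int (g (- 1))"
    "(1 - fps_X) ^ Suc n * Abs_fps (\<lambda>m. real_of_int (g (int m))) = fps_of_poly h"
  using assms
proof (induction n arbitrary: g thesis)
  case 0
  then have c: "g m = g (m - 1)" for m by simp
  have "g (int m) = g (- 1)" for m
  proof (induction m)
    case (Suc m)
    then show ?case using c[of "int (Suc m)"] by simp
  qed (use c[of 0] in simp)
  then have "(1 - fps_X) * Abs_fps (\<lambda>m. real_of_int (g (int m))) = fps_of_poly [:real_of_int (g (- 1)):]"
    by (auto simp: fps_eq_iff left_diff_distrib coeff_pCons split: nat.split)
  with 0 show ?case by (auto intro!: 0(1)[of "[:real_of_int (g (- 1)):]"])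
next
  case (Suc n)
  define g' where "g' m = g m - g (m - 1)" for m
  have "vanishing_diff (Suc n) g'" using Suc.prems(2) by (simp add: g'_def)
  then obtain h where h: "degree h \<le> n"
    "(1 - fps_X) ^ Suc n * Abs_fps (\<lambda>m. real_of_int (g' (int m))) = fps_of_poly h"
    by (rule Suc.IH[rotated])
  define q where "q = smult (real_of_int (g (- 1))) ([:1, - 1:] ^ Suc n) + h"
  have deg: "degree ([:1, - 1 :: real:] ^ Suc n) = Suc n"
    by (simp add: degree_power_eq del: power_Suc)
  have "coeff ([:1, - 1 :: real:] ^ Suc n) (Suc n) = (- 1) ^ Suc n"
    using lead_coeff_power[of "[:1, - 1 :: real:]" "Suc n"] unfolding deg by simp
  with h(1) have "coeff q (Suc n) = (- 1) ^ Suc n * real_of_int (g (- 1))"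
    by (simp add: q_def coeff_eq_0 del: power_Suc)
  moreover have "degree q \<le> Suc n"
    unfolding q_def using h(1) deg by (intro degree_add_le order.trans[OF degree_smult_le]) auto
  moreover have "(1 - fps_X) ^ Suc (Suc n) * Abs_fps (\<lambda>m. real_of_int (g (int m))) = fps_of_poly q"
  proof -
    have "(1 - fps_X) * Abs_fps (\<lambda>m. real_of_int (g (int m))) =
        fps_const (real_of_int (g (- 1))) + Abs_fps (\<lambda>m. real_of_int (g' (int m)))"
      by (rule fps_ext) (auto simp: left_diff_distrib g'_def split: nat.split)
    moreover have "(1 - fps_X :: real fps) = fps_of_poly [:1, - 1:]"
      by (simp add: fps_of_poly_pCons)
    then have "fps_of_poly q =
        (1 - fps_X) ^ Suc n * fps_const (real_of_int (g (- 1))) + fps_of_poly h"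
      by (simp only: q_def fps_of_poly_add fps_of_poly_smult fps_of_poly_power mult.commute)
    ultimately show ?thesis
      using h(2) unfolding power_Suc2[of _ "Suc n"] mult.assoc
      by (simp only: distrib_left)
  qed
  ultimately show ?case by (intro Suc.prems(1)[of q])
qed

section \<open>Tournament scores\<close>

definition outdeg :: "'v set \<Rightarrow> ('v \<times> 'v) set \<Rightarrow> 'v \<Rightarrow> nat" where
  "outdeg V T v = card {w \<in> V. (v, w) \<in> T}"

lemma choose_two_Suc: "Suc n choose 2 = (n choose 2) + n"
  by (simp add: numeral_2_eq_2)

lemma tournament_subset:
  assumes "tournament V T" "A \<subseteq> V"
  shows "tournament A (T \<inter> A \<times> A)"
  unfolding tournament_def
proof (intro conjI)
  show "finite A" using assms finite_subset by (auto simp: tournament_def)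
  show "asym (T \<inter> A \<times> A)" using assms(1) by (auto simp: tournament_def asym_iff)
  show "total_on A (T \<inter> A \<times> A)"
  proof (rule total_onI)
    fix x y assume "x \<in> A" "y \<in> A" "x \<noteq> y"
    moreover from this have "(x, y) \<in> T \<or> (y, x) \<in> T"
      using assms by (auto simp: tournament_def total_on_def)
    ultimately show "(x, y) \<in> T \<inter> A \<times> A \<or> (y, x) \<in> T \<inter> A \<times> A" by blast
  qed
qed blast

lemma tournament_outdeg_sum:
  assumes "tournament V T"
  shows "(\<Sum>v\<in>V. outdeg V T v) = card V choose 2"
proof -
  have fin: "finite V" and TV: "T \<subseteq> V \<times> V" and asym: "asym T" and total: "total_on V T"
    using assms by (auto simp: tournament_def)
  have finT: "finite T" using fin TV finite_subset by blast
  have "(\<Sum>v\<in>V. outdeg V T v) = card (SIGMA v:V. {w \<in> V. (v, w) \<in> T})"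
    unfolding outdeg_def using fin by (subst card_SigmaI) auto
  also have "(SIGMA v:V. {w \<in> V. (v, w) \<in> T}) = T" using TV by auto
  also have "card T = card {e. e \<subseteq> V \<and> card e = 2}"
  proof (rule bij_betw_same_card)
    show "bij_betw (\<lambda>(u, v). {u, v}) T {e. e \<subseteq> V \<and> card e = 2}"
    proof (rule bij_betw_imageI)
      show "inj_on (\<lambda>(u, v). {u, v}) T"
        using asym by (force simp: inj_on_def asym_iff doubleton_eq_iff)
      show "(\<lambda>(u, v). {u, v}) ` T = {e. e \<subseteq> V \<and> card e = 2}"
      proof (intro equalityI subsetI)
        fix e assume "e \<in> (\<lambda>(u, v). {u, v}) ` T"
        then obtain u v where "(u, v) \<in> T" "e = {u, v}" by auto
        moreover from this have "u \<in> V" "v \<in> V" "u \<noteq> v" using TV asym by (auto simp: asym_iff)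
        ultimately show "e \<in> {e. e \<subseteq> V \<and> card e = 2}" by simp
      next
        fix e assume "e \<in> {e. e \<subseteq> V \<and> card e = 2}"
        then obtain u v where "e = {u, v}" "u \<noteq> v" "u \<in> V" "v \<in> V" by (auto simp: card_2_iff)
        moreover from this have "(u, v) \<in> T \<or> (v, u) \<in> T"
          using total by (auto simp: total_on_def)
        ultimately show "e \<in> (\<lambda>(u, v). {u, v}) ` T" by (auto simp: insert_commute image_iff)
      qed
    qed
  qed
  also have "\<dots> = card V choose 2" using n_subsets[OF fin] by simp
  finally show ?thesis .
qed

text \<open>Arcs that start in \<open>A\<close> either stay inside, where they form a tournament on
  \<open>A\<close>, or leave it; the excess over the binomial coefficient counts the leaving
  ones.\<close>

lemma tournament_outdeg_sum_subset:
  assumes T: "tournament V T" and A: "A \<subseteq> V"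
  shows "(\<Sum>v\<in>A. outdeg V T v) = (card A choose 2) + card (T \<inter> A \<times> (V - A))"
proof -
  have fin: "finite V" and finA: "finite A" using T A finite_subset by (auto simp: tournament_def)
  have "outdeg V T v = outdeg A (T \<inter> A \<times> A) v + card {w \<in> V - A. (v, w) \<in> T}" if "v \<in> A" for v
  proof -
    have eq: "{w \<in> V. (v, w) \<in> T} = {w \<in> A. (v, w) \<in> T \<inter> A \<times> A} \<union> {w \<in> V - A. (v, w) \<in> T}"
      using A that by auto
    show ?thesis unfolding outdeg_def eq using fin finA by (intro card_Un_disjoint) auto
  qed
  then have "(\<Sum>v\<in>A. outdeg V T v) =
      (\<Sum>v\<in>A. outdeg A (T \<inter> A \<times> A) v) + (\<Sum>v\<in>A. card {w \<in> V - A. (v, w) \<in> T})"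
    by (simp add: sum.distrib)
  also have "(\<Sum>v\<in>A. card {w \<in> V - A. (v, w) \<in> T}) = card (SIGMA v:A. {w \<in> V - A. (v, w) \<in> T})"
    using fin finA by (subst card_SigmaI) auto
  also have "(SIGMA v:A. {w \<in> V - A. (v, w) \<in> T}) = T \<inter> A \<times> (V - A)" by auto
  also have "(\<Sum>v\<in>A. outdeg A (T \<inter> A \<times> A) v) = card A choose 2"
    by (rule tournament_outdeg_sum) (rule tournament_subset[OF T A])
  finally show ?thesis .
qed

text \<open>Strength fails exactly when some proper nonempty set has no leaving arc, for instance
  the set of vertices reachable from a vertex that misses another one. Leaving arcs are the excess
  in \<open>tournament_outdeg_sum_subset\<close>.\<close>

lemma strong_tournament_iff:
  assumes T: "tournament V T"
  shows "strong_tournament V T \<longleftrightarrow> V \<noteq> {} \<and>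
    (\<forall>A. A \<subset> V \<and> A \<noteq> {} \<longrightarrow> card A choose 2 < (\<Sum>v\<in>A. outdeg V T v))"
proof -
  have fin: "finite T" and TV: "T \<subseteq> V \<times> V" using T finite_subset by (auto simp: tournament_def)
  have "(\<forall>u\<in>V. \<forall>v\<in>V. (u, v) \<in> T\<^sup>*) \<longleftrightarrow>
      (\<forall>A. A \<subset> V \<and> A \<noteq> {} \<longrightarrow> T \<inter> A \<times> (V - A) \<noteq> {})"
  proof (intro iffI allI impI)
    fix A assume conn: "\<forall>u\<in>V. \<forall>v\<in>V. (u, v) \<in> T\<^sup>*" and A: "A \<subset> V \<and> A \<noteq> {}"
    show "T \<inter> A \<times> (V - A) \<noteq> {}"
    proof
      assume no: "T \<inter> A \<times> (V - A) = {}"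
      obtain u v where uv: "u \<in> A" "v \<in> V - A" using A by auto
      have "x \<in> A" if "(u, x) \<in> T\<^sup>*" for x
        using that by induction (use uv no TV in auto)
      with conn uv A show False by blast
    qed
  next
    assume cut: "\<forall>A. A \<subset> V \<and> A \<noteq> {} \<longrightarrow> T \<inter> A \<times> (V - A) \<noteq> {}"
    show "\<forall>u\<in>V. \<forall>v\<in>V. (u, v) \<in> T\<^sup>*"
    proof (intro ballI, rule ccontr)
      fix u v assume uv: "u \<in> V" "v \<in> V" "(u, v) \<notin> T\<^sup>*"
      define A where "A = {x \<in> V. (u, x) \<in> T\<^sup>*}"
      have "A \<subset> V \<and> A \<noteq> {}" using uv by (auto simp: A_def)
      with cut obtain x y where "(x, y) \<in> T" "x \<in> A" "y \<in> V - A" by blast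
      then show False by (auto simp: A_def intro: rtrancl_into_rtrancl)
    qed
  qed
  moreover have "T \<inter> A \<times> (V - A) \<noteq> {} \<longleftrightarrow> card A choose 2 < (\<Sum>v\<in>A. outdeg V T v)"
    if "A \<subset> V" for A
    using tournament_outdeg_sum_subset[OF T psubset_imp_subset[OF that]] fin
    by (simp add: card_gt_0_iff)
  then have "(\<forall>A. A \<subset> V \<and> A \<noteq> {} \<longrightarrow> T \<inter> A \<times> (V - A) \<noteq> {}) \<longleftrightarrow>
      (\<forall>A. A \<subset> V \<and> A \<noteq> {} \<longrightarrow> card A choose 2 < (\<Sum>v\<in>A. outdeg V T v))"
    by (intro all_cong1 imp_cong) simp_all
  ultimately show ?thesis by (simp only: strong_tournament_def T simp_thms)
qed

text \<open>The elementary move for Landau's theorem: reversing the arcs of a path one by one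
  transfers a unit of score from its start to its end.\<close>

lemma reverse_arc:
  assumes T: "tournament V T" and ab: "(a, b) \<in> T"
  defines "T' \<equiv> insert (b, a) (T - {(a, b)})"
  shows "tournament V T'"
    and "int (outdeg V T' v) = int (outdeg V T v) - of_bool (v = a) + of_bool (v = b)"
proof -
  have fin: "finite V" and TV: "T \<subseteq> V \<times> V" and asym: "asym T" and total: "total_on V T"
    using T by (auto simp: tournament_def)
  have ne: "a \<noteq> b" "(b, a) \<notin> T" and V: "a \<in> V" "b \<in> V" using ab asym TV by (auto simp: asym_iff)
  show "tournament V T'"
    using fin TV asym total V ne ab unfolding tournament_def T'_def total_on_def asym_iff by auto
  have "{w \<in> V. (a, w) \<in> T'} = {w \<in> V. (a, w) \<in> T} - {b}" "b \<in> {w \<in> V. (a, w) \<in> T}"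
    using ne ab V by (auto simp: T'_def)
  then have "outdeg V T a = Suc (outdeg V T' a)"
    unfolding outdeg_def using card_Suc_Diff1[of "{w \<in> V. (a, w) \<in> T}" b] fin by simp
  moreover have "{w \<in> V. (b, w) \<in> T'} = insert a {w \<in> V. (b, w) \<in> T}"
    using ne ab V by (auto simp: T'_def)
  then have "outdeg V T' b = Suc (outdeg V T b)"
    unfolding outdeg_def using fin ne by simp
  moreover have "outdeg V T' v = outdeg V T v" if "v \<noteq> a" "v \<noteq> b"
    unfolding outdeg_def T'_def using that by simp
  ultimately show "int (outdeg V T' v) = int (outdeg V T v) - of_bool (v = a) + of_bool (v = b)"
    using ne by auto
qed

text \<open>Landau's theorem. If two prescribed scores agree, moving one unit between them keeps the subset
  inequalities; reversing a path of length at most 2 then undoes the move.\<close>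

lemma landau:
  fixes s :: "'v \<Rightarrow> int"
  assumes "finite V" "\<And>A. A \<subseteq> V \<Longrightarrow> int (card A choose 2) \<le> sum s A"
    "sum s V = int (card V choose 2)"
  shows "\<exists>T. tournament V T \<and> (\<forall>v\<in>V. int (outdeg V T v) = s v)"
  using assms(2,3)
\<comment> \<open>Each move raises the sum of squares by 2, and \<open>card V ^ 3\<close> bounds
  that sum because no score exceeds \<open>card V\<close>; the moves end at pairwise distinct
  scores.\<close>
proof (induction "nat (int (card V) ^ 3 - (\<Sum>v\<in>V. (s v)\<^sup>2))" arbitrary: s rule: less_induct)
  case (less s)
  have fin: "finite A" if "A \<subseteq> V" for A using assms(1) that finite_subset by blast
  have nonneg: "0 \<le> s v" if "v \<in> V" for v
    using less.prems(1)[of "{v}"] that by simp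
  have upper: "s v < int (card V)" if v: "v \<in> V" for v
  proof -
    have V: "card V = Suc (card (V - {v}))" using v assms(1) by (metis card.remove)
    have "sum s V = s v + sum s (V - {v})" using v assms(1) by (simp add: sum.remove)
    with less.prems(1)[of "V - {v}"] less.prems(2) show ?thesis
      unfolding V by (simp add: choose_two_Suc)
  qed
  show ?case
  proof (cases "inj_on s V")
    case True
    \<comment> \<open>Distinct scores below \<open>card V\<close> fill the whole range, and the
      transitive tournament ordered by \<open>s\<close> realizes them.\<close>
    have sV: "s ` V = {0..<int (card V)}"
      by (rule card_subset_eq) (use nonneg upper True in \<open>auto simp: card_image\<close>)
    define T where "T = {(u, v). u \<in> V \<and> v \<in> V \<and> s v < s u}"
    have "tournament V T"
      using assms(1) True unfolding tournament_def T_def total_on_def asym_iff inj_on_def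
      by auto (metis not_less_iff_gr_or_eq)
    moreover have "int (outdeg V T v) = s v" if "v \<in> V" for v
    proof -
      have "s ` {w \<in> V. (v, w) \<in> T} = {0..<s v}"
      proof (intro equalityI subsetI)
        fix x assume x: "x \<in> {0..<s v}"
        with upper[OF that] have "x \<in> s ` V" by (simp add: sV)
        with x that show "x \<in> s ` {w \<in> V. (v, w) \<in> T}" by (auto simp: T_def)
      qed (use nonneg in \<open>auto simp: T_def\<close>)
      moreover have "card (s ` {w \<in> V. (v, w) \<in> T}) = outdeg V T v"
        unfolding outdeg_def by (rule card_image) (use True in \<open>auto simp: inj_on_def\<close>)
      ultimately show ?thesis using nonneg[OF that] by simp
    qed
    ultimately show ?thesis by blast
  next
    case False
    then obtain p q where pq: "p \<in> V" "q \<in> V" "p \<noteq> q" "s p = s q" by (auto simp: inj_on_def)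
    define s' where "s' v = s v - of_bool (v = p) + of_bool (v = q)" for v
    have sum': "sum s' A = sum s A - of_bool (p \<in> A) + of_bool (q \<in> A)" if "A \<subseteq> V" for A
      unfolding s'_def using fin[OF that] by (simp add: sum.distrib sum_subtractf of_bool_def)
    have sub: "int (card A choose 2) \<le> sum s' A" if A: "A \<subseteq> V" for A
    proof (cases "p \<in> A \<and> q \<notin> A \<and> sum s A = int (card A choose 2)")
      case True
      \<comment> \<open>Only a tight set containing \<open>p\<close> but not \<open>q\<close> could
        break, and there is none: adding \<open>q\<close> gives \<open>s q \<ge> k + 1\<close>,
        removing \<open>p\<close> gives \<open>s p \<le> k\<close>, yet the two scores
        agree.\<close>
      obtain k where k: "card A = Suc k" using True fin[OF A] by (cases "card A") auto
      have "int (Suc (Suc k) choose 2) \<le> sum s A + s q"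
        using less.prems(1)[of "insert q A"] pq A True fin[OF A] k by simp
      moreover have "int (k choose 2) \<le> sum s A - s p"
        using less.prems(1)[of "A - {p}"] pq A True fin[OF A] k by (auto simp: sum_diff1)
      ultimately show ?thesis using pq(4) True k by (simp add: choose_two_Suc)
    next
      case False
      then show ?thesis using less.prems(1)[OF A] sum'[OF A] by auto
    qed
    have sq: "(\<Sum>v\<in>V. (s' v)\<^sup>2) = (\<Sum>v\<in>V. (s v)\<^sup>2) + 2"
    proof -
      have "(s' v)\<^sup>2 = (s v)\<^sup>2 + (of_bool (v = p) * (1 - 2 * s p) + of_bool (v = q) * (1 + 2 * s q))" for v
        using pq(3) by (auto simp: s'_def power2_eq_square algebra_simps)
      then show ?thesis
        using assms(1) pq by (simp add: sum.distrib of_bool_def if_distrib[of "\<lambda>x. x * _"] cong: if_cong)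
    qed
    have "(\<Sum>v\<in>V. (s' v)\<^sup>2) \<le> int (card V) ^ 3"
    proof -
      have s': "0 \<le> s' v" if "v \<in> V" for v using sub[of "{v}"] that by simp
      have "s' v \<le> int (card V)" if "v \<in> V" for v using upper[OF that] pq(3) by (auto simp: s'_def)
      then have "(\<Sum>v\<in>V. (s' v)\<^sup>2) \<le> (\<Sum>v\<in>V. (int (card V))\<^sup>2)"
        using s' by (intro sum_mono power_mono) auto
      then show ?thesis by (simp add: power2_eq_square power3_eq_cube)
    qed
    then have "nat (int (card V) ^ 3 - (\<Sum>v\<in>V. (s' v)\<^sup>2)) < nat (int (card V) ^ 3 - (\<Sum>v\<in>V. (s v)\<^sup>2))"
      unfolding sq by simp
    from less.hyps[OF this sub] obtain T where
      T: "tournament V T" "\<And>v. v \<in> V \<Longrightarrow> int (outdeg V T v) = s' v"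
      using sum'[of V] pq less.prems(2) by auto
    show ?thesis
    proof (cases "(q, p) \<in> T")
      case True
      have "\<forall>v\<in>V. int (outdeg V (insert (p, q) (T - {(q, p)})) v) = s v"
        using T(2) by (simp add: reverse_arc(2)[OF T(1) True] s'_def)
      with reverse_arc(1)[OF T(1) True] show ?thesis by blast
    next
      case False
      \<comment> \<open>Otherwise \<open>p\<close> beats every vertex that \<open>q\<close> beats,
        although in \<open>T\<close> the score of \<open>q\<close> exceeds that of \<open>p\<close>
        by 2.\<close>
      have "\<exists>w. (q, w) \<in> T \<and> (w, p) \<in> T"
      proof (rule ccontr)
        assume none: "\<nexists>w. (q, w) \<in> T \<and> (w, p) \<in> T"
        have "{w \<in> V. (q, w) \<in> T} \<subseteq> {w \<in> V. (p, w) \<in> T}"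
        proof
          fix w assume w: "w \<in> {w \<in> V. (q, w) \<in> T}"
          then have "w \<noteq> p" "(w, p) \<notin> T" using False none by auto
          then show "w \<in> {w \<in> V. (p, w) \<in> T}"
            using T(1) w pq by (auto simp: tournament_def total_on_def)
        qed
        then have "outdeg V T q \<le> outdeg V T p"
          unfolding outdeg_def using assms(1) by (intro card_mono) auto
        with T(2)[of p] T(2)[of q] pq show False by (simp add: s'_def)
      qed
      then obtain w where w: "(q, w) \<in> T" "(w, p) \<in> T" by blast
      define T1 where "T1 = insert (w, q) (T - {(q, w)})"
      have T1: "tournament V T1"
        "int (outdeg V T1 v) = int (outdeg V T v) - of_bool (v = q) + of_bool (v = w)" for v
        using reverse_arc[OF T(1) w(1)] by (simp_all add: T1_def)
      have wp: "(w, p) \<in> T1" using w T(1) by (auto simp: T1_def tournament_def asym_iff)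
      have "\<forall>v\<in>V. int (outdeg V (insert (p, w) (T1 - {(w, p)})) v) = s v"
        using T(2) by (simp add: reverse_arc(2)[OF T1(1) wp] T1(2) s'_def)
      with reverse_arc(1)[OF T1(1) wp] show ?thesis by blast
    qed
  qed
qed

section \<open>Score sequences as sorted lists\<close>

lemma score_sequence_altdef:
  assumes "finite V"
  obtains xs where "distinct xs" "set xs = V" "score_sequence V T = map (outdeg V T) xs"
    "sorted (map (outdeg V T) xs)"
proof -
  obtain ys where ys: "set ys = V" "distinct ys" using assms finite_distinct_list by blast
  define xs where "xs = sort_key (outdeg V T) ys"
  have "mset xs = mset_set V" using mset_set_set[OF ys(2)] ys(1) by (simp add: xs_def)
  then have "score_sequence V T = sorted_list_of_multiset (mset (map (outdeg V T) xs))"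
    unfolding score_sequence_def outdeg_def by simp
  also have "\<dots> = map (outdeg V T) xs"
    unfolding sorted_list_of_multiset_mset by (rule sorted_sort_id) (simp add: xs_def)
  finally show ?thesis using that[of xs] ys by (simp add: xs_def)
qed

text \<open>Counting from 0, the i-th smallest element of \<open>A\<close> is at least i, so a
  prefix of a sorted list is the cheapest index set of its size. This reduces inequalities over
  subsets of vertices to inequalities over prefixes.\<close>

lemma sum_list_take_le_sum:
  fixes c :: "nat list"
  assumes "sorted c" "A \<subseteq> {..<length c}"
  shows "sum_list (take (card A) c) \<le> (\<Sum>i\<in>A. c ! i)"
proof -
  have finA: "finite A" using assms(2) finite_subset by blast
  define as where "as = sorted_list_of_set A"
  have as: "length as = card A" "set as = A" "distinct as" "sorted_wrt (<) as"
    using finA by (simp_all add: as_def)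
  have le: "card A \<le> length c" using card_mono[OF _ assms(2)] by simp
  have "c ! i \<le> c ! (as ! i)" if "i < card A" for i
  proof (rule sorted_nth_mono[OF assms(1)])
    show "i \<le> as ! i" using sorted_wrt_less_idx[OF as(4)] that as(1) by simp
    show "as ! i < length c" using as(1,2) assms(2) that nth_mem[of i as] by auto
  qed
  then have "(\<Sum>i<card A. c ! i) \<le> (\<Sum>i<card A. c ! (as ! i))" by (intro sum_mono) simp
  also have "\<dots> = sum_list (map ((!) c) as)"
    by (simp add: sum_list_sum_nth as(1) atLeast0LessThan)
  also have "\<dots> = (\<Sum>i\<in>A. c ! i)"
    using as(2,3) sum_list_distinct_conv_sum_set by fastforce
  also have "(\<Sum>i<card A. c ! i) = sum_list (take (card A) c)"
    using le by (simp add: sum_list_sum_nth atLeast0LessThan)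
  finally show ?thesis .
qed

text \<open>Landau's theorem supplies a tournament with the given scores, and the strict prefix
  inequalities, extended to all proper nonempty subsets, make it strong by
  \<open>strong_tournament_iff\<close>.\<close>

lemma strong_score_sequences_eq:
  assumes d: "1 \<le> d"
  shows "strong_score_sequences d = {c. sorted c \<and> length c = d \<and> sum_list c = d choose 2 \<and>
    (\<forall>k. 0 < k \<and> k < d \<longrightarrow> k choose 2 < sum_list (take k c))}"
proof (intro equalityI subsetI)
  fix c assume "c \<in> strong_score_sequences d"
  then obtain T where T: "strong_tournament {1..d} T" "c = score_sequence {1..d} T"
    by (auto simp: strong_score_sequences_def)
  obtain xs where xs: "distinct xs" "set xs = {1..d}" "c = map (outdeg {1..d} T) xs"
    "sorted (map (outdeg {1..d} T) xs)"
    using score_sequence_altdef[of "{1..d}" T] T(2) by auto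
  have trn: "tournament {1..d} T" using T by (simp add: strong_tournament_def)
  have len: "length xs = d" using distinct_card[OF xs(1)] xs(2) by simp
  have "sum_list c = d choose 2"
    using tournament_outdeg_sum[OF trn] xs(2,3)
      sum_list_distinct_conv_sum_set[OF xs(1), of "outdeg {1..d} T"] by simp
  moreover have "k choose 2 < sum_list (take k c)" if k: "0 < k" "k < d" for k
  proof -
    have dist: "distinct (take k xs)" using xs(1) by simp
    have card: "card (set (take k xs)) = k" using distinct_card[OF dist] k len by simp
    have "set (take k xs) \<subset> {1..d}"
      using set_take_subset[of k xs] xs(2) card k by auto
    moreover have "set (take k xs) \<noteq> {}" using card k by auto
    ultimately have "k choose 2 < (\<Sum>v\<in>set (take k xs). outdeg {1..d} T v)"
      using conjunct2[OF iffD1[OF strong_tournament_iff[OF trn] T(1)], rule_format,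
          of "set (take k xs)"] card by simp
    then show ?thesis using sum_list_distinct_conv_sum_set[OF dist, of "outdeg {1..d} T"]
      by (simp add: xs(3) take_map)
  qed
  ultimately show "c \<in> {c. sorted c \<and> length c = d \<and> sum_list c = d choose 2 \<and>
      (\<forall>k. 0 < k \<and> k < d \<longrightarrow> k choose 2 < sum_list (take k c))}"
    using xs len by simp
next
  fix c assume c: "c \<in> {c. sorted c \<and> length c = d \<and> sum_list c = d choose 2 \<and>
      (\<forall>k. 0 < k \<and> k < d \<longrightarrow> k choose 2 < sum_list (take k c))}"
  define s where "s v = c ! (v - 1)" for v
  have sum_ge: "sum_list (take (card A) c) \<le> sum s A" if "A \<subseteq> {1..d}" for A
  proof -
    have inj: "inj_on (\<lambda>v. v - 1) A" using that by (intro inj_on_diff_nat) auto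
    have "v - 1 < length c" if "v \<in> A" for v
      using subsetD[OF \<open>A \<subseteq> {1..d}\<close> that] c by auto
    then have "(\<lambda>v. v - 1) ` A \<subseteq> {..<length c}" by auto
    with c have "sum_list (take (card ((\<lambda>v. v - 1) ` A)) c) \<le> (\<Sum>i\<in>(\<lambda>v. v - 1) ` A. c ! i)"
      by (intro sum_list_take_le_sum) auto
    then show ?thesis using inj by (simp add: card_image sum.reindex s_def)
  qed
  have s_mset: "image_mset s (mset_set {1..d}) = mset c"
  proof -
    have "map s [1..<Suc d] = c" using c by (intro nth_equalityI) (auto simp: s_def simp del: upt_Suc)
    moreover have "mset (map s [1..<Suc d]) = image_mset s (mset_set {1..d})"
      by (simp only: mset_map mset_upt atLeastLessThanSuc_atLeastAtMost)
    ultimately show ?thesis by simp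
  qed
  have sum_all: "sum s {1..d} = d choose 2"
    using arg_cong[OF s_mset, of sum_mset] c by (simp add: sum_mset_sum_list sum_unfold_sum_mset)
  have strict: "card A choose 2 < sum s A" if "A \<subset> {1..d}" "A \<noteq> {}" for A
  proof -
    have "finite A" using that finite_subset by blast
    then have "0 < card A" using that by (simp add: card_gt_0_iff)
    moreover have "card A < d" using psubset_card_mono[OF _ that(1)] by simp
    ultimately show ?thesis using c sum_ge[of A] that
      by (auto intro: less_le_trans)
  qed
  have "int (card A choose 2) \<le> (\<Sum>v\<in>A. int (s v))" if "A \<subseteq> {1..d}" for A
  proof -
    consider "A = {}" | "A = {1..d}" | "A \<subset> {1..d}" "A \<noteq> {}"
      using \<open>A \<subseteq> {1..d}\<close> by blast
    then have "card A choose 2 \<le> sum s A"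
    proof cases
      case 3
      then show ?thesis using strict[of A] by simp
    qed (use sum_all in \<open>simp_all add: binomial_eq_0\<close>)
    then show ?thesis by (simp flip: of_nat_sum)
  qed
  moreover have "(\<Sum>v\<in>{1..d}. int (s v)) = int (card {1..d} choose 2)"
    using sum_all by (simp flip: of_nat_sum)
  ultimately have "\<exists>T. tournament {1..d} T \<and> (\<forall>v\<in>{1..d}. int (outdeg {1..d} T v) = int (s v))"
    by (intro landau) auto
  then obtain T where T: "tournament {1..d} T" "\<And>v. v \<in> {1..d} \<Longrightarrow> outdeg {1..d} T v = s v"
    by auto
  have "strong_tournament {1..d} T"
    unfolding strong_tournament_iff[OF T(1)]
  proof (intro conjI allI impI)
    fix A assume A: "A \<subset> {1..d} \<and> A \<noteq> {}"
    then have "sum (outdeg {1..d} T) A = sum s A"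
      by (intro sum.cong[OF refl] T(2)) blast
    then show "card A choose 2 < sum (outdeg {1..d} T) A" using strict[of A] A by simp
  qed (use d in auto)
  moreover have "score_sequence {1..d} T = c"
  proof -
    have "score_sequence {1..d} T = sorted_list_of_multiset (image_mset (outdeg {1..d} T) (mset_set {1..d}))"
      unfolding score_sequence_def outdeg_def ..
    also have "image_mset (outdeg {1..d} T) (mset_set {1..d}) = mset c"
      unfolding s_mset[symmetric] by (rule image_mset_cong) (use T(2) in simp)
    finally show ?thesis using c by (simp add: sorted_sort_id)
  qed
  ultimately show "c \<in> strong_score_sequences d" unfolding strong_score_sequences_def by blast
qed

lemma sum_telescope_excess:
  fixes u :: "nat \<Rightarrow> int"
  shows "(\<Sum>i<k. int i + u (Suc i) - u i) = int (k choose 2) + u k - u 0"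
  by (induction k) (simp_all add: choose_two_Suc)

text \<open>For the excess of the partial sums over those of 0, 1, 2, ... sortedness becomes
  \<open>lap u k \<le> 1\<close>, the strict prefix inequalities become positivity, and the
  prescribed total makes the excess vanish at \<open>d\<close>.\<close>

lemma card_strong_score_sequences:
  assumes d: "1 \<le> d"
  shows "card (strong_score_sequences d) =
    card {u \<in> interior_funs 0 d. \<forall>k\<in>{0<..<d}. 0 < u k \<and> lap u k \<le> (1 :: int)}" (is "_ = card ?S")
proof (rule bij_betw_same_card)
  define \<phi> :: "nat list \<Rightarrow> nat \<Rightarrow> int" where
    "\<phi> c k = (if k \<le> d then int (sum_list (take k c)) - int (k choose 2) else 0)" for c k
  define \<psi> :: "(nat \<Rightarrow> int) \<Rightarrow> nat list" where
    "\<psi> u = map (\<lambda>i. nat (int i + u (Suc i) - u i)) [0..<d]" for u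
  have step: "\<phi> c (Suc i) - \<phi> c i = int (c ! i) - int i" if "length c = d" "i < d" for c i
    using that by (simp add: \<phi>_def take_Suc_conv_app_nth choose_two_Suc)
  \<comment> \<open>\<open>\<psi>\<close> truncates by \<open>nat\<close>, so the recovered entries
    must be nonnegative: the first one is \<open>u 1\<close>, and \<open>lap u \<le> 1\<close> makes
    them nondecreasing.\<close>
  have e_nonneg: "0 \<le> int i + u (Suc i) - u i" if u: "u \<in> ?S" and "i < d" for u i
    using \<open>i < d\<close>
  proof (induction i)
    case 0
    have u0: "u 0 = 0" using u by (simp add: interior_funs_def)
    show ?case
    proof (cases "d = 1")
      case True
      with u have "u (Suc 0) = 0" by (simp add: interior_funs_def)
      with u0 show ?thesis by simp
    next
      case False
      with u d have "0 < u (Suc 0)" by auto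
      with u0 show ?thesis by simp
    qed
  next
    case (Suc i)
    then have "lap u (Suc i) \<le> 1" using u by auto
    then show ?case using Suc by (simp add: lap_def)
  qed
  show "bij_betw \<phi> (strong_score_sequences d) ?S"
    unfolding strong_score_sequences_eq[OF d]
  proof (rule bij_betw_byWitness[where f' = \<psi>])
    show "\<forall>c\<in>{c. sorted c \<and> length c = d \<and> sum_list c = d choose 2 \<and>
        (\<forall>k. 0 < k \<and> k < d \<longrightarrow> k choose 2 < sum_list (take k c))}. \<psi> (\<phi> c) = c"
    proof
      fix c assume "c \<in> {c. sorted c \<and> length c = d \<and> sum_list c = d choose 2 \<and>
        (\<forall>k. 0 < k \<and> k < d \<longrightarrow> k choose 2 < sum_list (take k c))}"
      then have c: "length c = d" by simp
      have "int i + \<phi> c (Suc i) - \<phi> c i = int (c ! i)" if "i < d" for i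
        using step[OF c that] by linarith
      then show "\<psi> (\<phi> c) = c" using c by (intro nth_equalityI) (simp_all add: \<psi>_def)
    qed
    have sum_take: "int (sum_list (take k (\<psi> u))) = int (k choose 2) + u k"
      if u: "u \<in> ?S" and k: "k \<le> d" for u k
    proof -
      have "int (sum_list (take k (\<psi> u))) = (\<Sum>i<k. int (nat (int i + u (Suc i) - u i)))"
        using k by (simp add: \<psi>_def take_map sum_list_sum_nth atLeast0LessThan)
      also have "\<dots> = (\<Sum>i<k. int i + u (Suc i) - u i)"
        using e_nonneg[OF u] k by (intro sum.cong) auto
      finally show ?thesis using u by (simp add: sum_telescope_excess interior_funs_def)
    qed
    then show "\<forall>u\<in>?S. \<phi> (\<psi> u) = u"
      by (auto simp: \<phi>_def fun_eq_iff interior_funs_def)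
    show "\<phi> ` {c. sorted c \<and> length c = d \<and> sum_list c = d choose 2 \<and>
        (\<forall>k. 0 < k \<and> k < d \<longrightarrow> k choose 2 < sum_list (take k c))} \<subseteq> ?S"
    proof (rule image_subsetI)
      fix c assume c: "c \<in> {c. sorted c \<and> length c = d \<and> sum_list c = d choose 2 \<and>
        (\<forall>k. 0 < k \<and> k < d \<longrightarrow> k choose 2 < sum_list (take k c))}"
      have "\<phi> c \<in> interior_funs 0 d"
        using c by (auto simp: interior_funs_def \<phi>_def)
      moreover have "0 < \<phi> c k \<and> lap (\<phi> c) k \<le> 1" if k: "k \<in> {0<..<d}" for k
      proof -
        obtain i where i: "k = Suc i" using k by (cases k) auto
        have "c ! i \<le> c ! k" using c k i by (auto intro: sorted_nth_mono)
        then have "lap (\<phi> c) k \<le> 1"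
          using step[of c i] step[of c k] c k i by (simp add: lap_def)
        then show ?thesis using c k by (simp add: \<phi>_def)
      qed
      ultimately show "\<phi> c \<in> ?S" by blast
    qed
    show "\<psi> ` ?S \<subseteq> {c. sorted c \<and> length c = d \<and> sum_list c = d choose 2 \<and>
        (\<forall>k. 0 < k \<and> k < d \<longrightarrow> k choose 2 < sum_list (take k c))}"
    proof (rule image_subsetI)
      fix u assume u: "u \<in> ?S"
      have len: "length (\<psi> u) = d" by (simp add: \<psi>_def)
      have "sorted (\<psi> u)"
        unfolding sorted_iff_nth_Suc
      proof (intro allI impI)
        fix i assume i: "Suc i < length (\<psi> u)"
        then have "lap u (Suc i) \<le> 1" using u len by auto
        then have "int i + u (Suc i) - u i \<le> int (Suc i) + u (Suc (Suc i)) - u (Suc i)"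
          by (simp add: lap_def)
        then show "\<psi> u ! i \<le> \<psi> u ! Suc i" using i len by (simp add: \<psi>_def)
      qed
      moreover have "sum_list (\<psi> u) = d choose 2"
        using sum_take[OF u, of d] len u by (simp add: interior_funs_def)
      moreover have "k choose 2 < sum_list (take k (\<psi> u))" if "0 < k" "k < d" for k
      proof -
        have "0 < u k" using u that by simp
        then show ?thesis using sum_take[OF u, of k] that by linarith
      qed
      ultimately show "\<psi> u \<in> {c. sorted c \<and> length c = d \<and> sum_list c = d choose 2 \<and>
          (\<forall>k. 0 < k \<and> k < d \<longrightarrow> k choose 2 < sum_list (take k c))}"
        using len by simp
    qed
  qed
qed

section \<open>The polytopes in partial-sum coordinates\<close>

text \<open>Generic in the number type: over the reals it describes the polytopes, over the integers
  the lattice points of their dilates.\<close>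

definition lap_polytope :: "nat \<Rightarrow> 'a::linordered_idom \<Rightarrow> (nat \<Rightarrow> 'a) set" where
  "lap_polytope d c = {u \<in> interior_funs 0 d. \<forall>k\<in>{0<..<d}. 0 \<le> u k \<and> lap u k \<le> c}"

text \<open>The way back from partial-sum coordinates: \<open>\<beta>\<close> is the extreme
  sequence and \<open>\<sigma>\<close> the sign of the deviation from it. The sign is 1 for R_d,
  whose extreme sequence 0, ..., d - 1 has the smallest partial sums, and -1 for P_d, where d, ...,
  1 has the largest.\<close>

definition diff_point :: "nat \<Rightarrow> (nat \<Rightarrow> real) \<Rightarrow> real \<Rightarrow> (nat \<Rightarrow> real) \<Rightarrow> nat \<Rightarrow> real" where
  "diff_point d \<beta> \<sigma> u = (\<lambda>i. if i \<in> {1..d} then \<beta> i + \<sigma> * (u i - u (i - 1)) else 0)"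

text \<open>Every integer multiple of \<open>v\<close> lies in the same polytope, which is bounded.\<close>

lemma lap_polytope_zero:
  assumes "v \<in> lap_polytope d (0 :: int)"
  shows "v j = 0"
proof -
  \<comment> \<open>The bound used below is \<open>parab 0 d j\<close>; a multiple of
    \<open>v j\<close> by anything larger can respect it only if \<open>v j\<close> is 0.\<close>
  define N where "N = parab 0 d j + 1"
  have N: "0 < N" using parab_nonneg[of 0 d j] by (simp add: N_def)
  define w where "w i = N * v i" for i
  have lapw: "lap w k = N * lap v k" for k by (simp add: w_def lap_def algebra_simps)
  have "w \<in> ssupp 0 d (\<lambda>_. 0)"
    unfolding ssupp_def mem_Collect_eq sterm_nonzero_iff
    using assms N by (auto simp: lapw w_def lap_polytope_def interior_funs_def mult_nonneg_nonpos)
  then have "\<bar>w j\<bar> \<le> 1 * parab 0 d j" by (rule ssupp_bound) auto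
  then have "N * \<bar>v j\<bar> < N * 1" using N by (simp add: w_def abs_mult N_def)
  then have "\<bar>v j\<bar> < 1" using N by (simp only: mult_less_cancel_left_pos)
  then show ?thesis by simp
qed

lemma eq_of_differences_eq:
  fixes v w :: "nat \<Rightarrow> 'a::ab_group_add"
  assumes "v \<in> interior_funs 0 d" "w \<in> interior_funs 0 d"
    "\<And>i. i \<in> {1..d} \<Longrightarrow> v i - v (i - 1) = w i - w (i - 1)"
  shows "v = w"
proof
  fix i
  have zero: "v j = 0" "w j = 0" if "j = 0 \<or> d \<le> j" for j
    using assms(1,2) that by (auto simp: interior_funs_def)
  show "v i = w i"
  proof (induction i)
    case (Suc i)
    show ?case
    proof (cases "Suc i \<le> d")
      case True
      then show ?thesis using assms(3)[of "Suc i"] Suc by simp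
    qed (use zero in simp)
  qed (use zero in simp)
qed

text \<open>As \<open>\<sigma>\<close> is a unit of the integers and \<open>u 0 = 0\<close>, summing
  coordinates recovers \<open>real m * u\<close> from a dilated point. The point is thus integral
  exactly if \<open>real m * u\<close> is.\<close>

lemma card_lattice_points_diff_point:
  fixes \<beta> :: "nat \<Rightarrow> int" and \<sigma> c :: int
  assumes \<sigma>: "\<sigma> = 1 \<or> \<sigma> = - 1" and c: "0 \<le> c"
  shows "card {x \<in> (\<lambda>y. real m *\<^sub>R y) ` diff_point d (\<lambda>i. of_int (\<beta> i)) (of_int \<sigma>) ` lap_polytope d (of_int c).
      \<forall>i. x i \<in> \<int>} = card (lap_polytope d (int m * c))" (is "card ?X = card ?V")
proof -
  have \<sigma>2: "\<sigma> * \<sigma> = 1" using \<sigma> by auto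
  have \<sigma>2r: "real_of_int \<sigma> * (real_of_int \<sigma> * x) = x" for x using \<sigma> by auto
  define F where "F v = (\<lambda>i. if i \<in> {1..d}
    then of_int (int m * \<beta> i + \<sigma> * (v i - v (i - 1))) else (0 :: real))" for v
  have inj: "inj_on F ?V"
  proof (rule inj_onI)
    fix v w assume "v \<in> ?V" "w \<in> ?V" and F: "F v = F w"
    then have V: "v \<in> interior_funs 0 d" "w \<in> interior_funs 0 d"
      by (auto simp: lap_polytope_def)
    show "v = w"
    proof (rule eq_of_differences_eq[OF V])
      fix i assume i: "i \<in> {1..d}"
      have "(of_int (int m * \<beta> i + \<sigma> * (v i - v (i - 1))) :: real) =
          of_int (int m * \<beta> i + \<sigma> * (w i - w (i - 1)))"
        using fun_cong[OF F, of i] i unfolding F_def by (simp only: if_True)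
      then have "\<sigma> * (v i - v (i - 1)) = \<sigma> * (w i - w (i - 1))"
        by (simp only: of_int_eq_iff add_left_cancel)
      then show "v i - v (i - 1) = w i - w (i - 1)" using \<sigma> by auto
    qed
  qed
  have "F ` ?V = ?X"
  proof (intro equalityI subsetI)
    fix x assume "x \<in> F ` ?V"
    then obtain v where v: "v \<in> ?V" "x = F v" by blast
    \<comment> \<open>For \<open>m = 0\<close> the quotient is 0 by convention; \<open>vu\<close>
      still holds there because \<open>lap_polytope_zero\<close> forces \<open>v\<close> to
      vanish.\<close>
    define u where "u i = real_of_int (v i) / real m" for i
    have vu: "real_of_int (v i) = real m * u i" for i
    proof (cases "m = 0")
      case True
      then show ?thesis using lap_polytope_zero[of v d i] v(1) by simp
    qed (simp add: u_def)
    have "u \<in> lap_polytope d (of_int c)"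
    proof -
      have "lap u k \<le> of_int c" if k: "k \<in> {0<..<d}" for k
      proof (cases "m = 0")
        case True
        then show ?thesis using c by (simp add: u_def lap_def)
      next
        case False
        have "real m * lap u k = of_int (lap v k)"
          by (simp add: lap_def vu right_diff_distrib)
        also have "\<dots> \<le> of_int (int m * c)"
          using v(1) k by (simp only: of_int_le_iff) (auto simp: lap_polytope_def)
        finally show ?thesis using False by simp
      qed
      then show ?thesis using v(1) by (simp add: lap_polytope_def interior_funs_def u_def)
    qed
    moreover have "x = real m *\<^sub>R diff_point d (\<lambda>i. of_int (\<beta> i)) (of_int \<sigma>) u"
      by (auto simp: v(2) F_def diff_point_def scaleR_fun_def fun_eq_iff vu algebra_simps)
    moreover have "x i \<in> \<int>" for i unfolding v(2) F_def by (simp only: Ints_of_int Ints_0 split: if_split) simp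
    ultimately show "x \<in> ?X" by blast
  next
    fix x assume "x \<in> ?X"
    then obtain u where u: "u \<in> lap_polytope d (of_int c)" and xint: "\<And>i. x i \<in> \<int>"
      and x: "x = real m *\<^sub>R diff_point d (\<lambda>i. of_int (\<beta> i)) (of_int \<sigma>) u" by blast
    have x_eq: "x i = real m * of_int (\<beta> i) + of_int \<sigma> * (real m * u i - real m * u (i - 1))"
      if "i \<in> {1..d}" for i
      using that by (simp add: x diff_point_def scaleR_fun_def algebra_simps)
    have u0: "u j = 0" if "j = 0 \<or> d \<le> j" for j
      using u that by (auto simp: lap_polytope_def interior_funs_def)
    have int: "real m * u i \<in> \<int>" for i
    proof (induction i)
      case (Suc i)
      show ?case
      proof (cases "Suc i \<le> d")
        case True
        have "real m * u (Suc i) = real m * u i + of_int \<sigma> * (x (Suc i) - real m * of_int (\<beta> (Suc i)))"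
          using x_eq[of "Suc i"] True by (simp add: \<sigma>2r)
        then show ?thesis using Suc xint by (metis Ints_add Ints_mult Ints_diff Ints_of_int Ints_of_nat)
      qed (simp add: u0)
    qed (simp add: u0)
    define v where "v i = \<lfloor>real m * u i\<rfloor>" for i
    have vu: "real_of_int (v i) = real m * u i" for i
      using int[of i] unfolding v_def by (auto elim: Ints_cases)
    have "v \<in> ?V"
    proof -
      have "lap v k \<le> int m * c" if k: "k \<in> {0<..<d}" for k
      proof -
        have "of_int (lap v k) = real m * lap u k"
          by (simp add: lap_def vu right_diff_distrib)
        also have "\<dots> \<le> real m * of_int c"
          using u k by (intro mult_left_mono) (auto simp: lap_polytope_def)
        finally have "real_of_int (lap v k) \<le> real_of_int (int m * c)" by simp
        then show ?thesis by (simp only: of_int_le_iff)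
      qed
      moreover have "0 \<le> v k" if k: "k \<in> {0<..<d}" for k
        using u k by (simp add: v_def lap_polytope_def)
      moreover have "v \<in> interior_funs 0 d"
        using u by (simp add: v_def lap_polytope_def interior_funs_def)
      ultimately show ?thesis by (simp add: lap_polytope_def)
    qed
    moreover have "x = F v"
    proof
      fix i
      show "x i = F v i"
      proof (cases "i \<in> {1..d}")
        case True
        then show ?thesis unfolding x_eq[OF True] by (simp add: F_def vu)
      next
        case False
        then show ?thesis by (auto simp: F_def x diff_point_def scaleR_fun_def)
      qed
    qed
    ultimately show "x \<in> F ` ?V" by blast
  qed
  with inj show ?thesis by (metis card_image)
qed

section \<open>Splitting points of the polytope until vertices remain\<close>

text \<open>The ratio test of the simplex method: the largest step that keeps all slacks nonnegative
  makes one more of them zero, while \<open>tight\<close> preserves those already zero. The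
  decreasing slack at \<open>j\<close> guarantees that a largest step exists.\<close>

lemma affine_move:
  fixes s e :: "'i \<Rightarrow> real"
  assumes I: "finite I" and s: "\<And>i. i \<in> I \<Longrightarrow> 0 \<le> s i"
    and tight: "\<And>i. i \<in> I \<Longrightarrow> s i = 0 \<Longrightarrow> e i = 0" and neg: "j \<in> I" "e j < 0"
  obtains t where "0 < t" "\<And>i. i \<in> I \<Longrightarrow> 0 \<le> s i + t * e i"
    "card {i \<in> I. s i + t * e i \<noteq> 0} < card {i \<in> I. s i \<noteq> 0}"
proof -
  define N where "N = {i \<in> I. e i < 0}"
  define q where "q i = s i / - e i" for i
  have N: "finite N" "N \<noteq> {}" using I neg by (auto simp: N_def)
  define t where "t = Min (q ` N)"
  have "t \<in> q ` N" unfolding t_def using N by (intro Min_in) auto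
  then obtain i0 where i0: "i0 \<in> N" "t = q i0" by blast
  have si0: "0 < s i0" using s[of i0] tight[of i0] i0(1) by (force simp: N_def)
  then have "0 < t" using i0 by (simp add: q_def N_def divide_pos_neg)
  moreover have "0 \<le> s i + t * e i" if i: "i \<in> I" for i
  proof (cases "e i < 0")
    case True
    then have "t \<le> q i" unfolding t_def using i N(1) by (intro Min_le) (auto simp: N_def)
    then have "t * - e i \<le> s i" using True unfolding q_def by (subst (asm) pos_le_divide_eq) auto
    then show ?thesis by simp
  next
    case False
    then show ?thesis using s[OF i] \<open>0 < t\<close> by simp
  qed
  moreover have "card {i \<in> I. s i + t * e i \<noteq> 0} < card {i \<in> I. s i \<noteq> 0}"
  proof (rule psubset_card_mono)
    have "s i0 + t * e i0 = 0" using i0 by (simp add: q_def N_def)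
    moreover have "i0 \<in> I" using i0(1) by (simp add: N_def)
    ultimately show "{i \<in> I. s i + t * e i \<noteq> 0} \<subset> {i \<in> I. s i \<noteq> 0}"
      using si0 tight by auto
  qed (use I in simp)
  ultimately show ?thesis using that by blast
qed

text \<open>The boolean selects one of the two constraints at \<open>k\<close>. With
  \<open>c = 0\<close> this is the linear part, the rate at which slacks change along a
  direction.\<close>

definition slack :: "'a::linordered_idom \<Rightarrow> (nat \<Rightarrow> 'a) \<Rightarrow> nat \<times> bool \<Rightarrow> 'a" where
  "slack c u = (\<lambda>(k, lower). if lower then u k else c - lap u k)"

lemma lap_polytope_slack:
  "u \<in> lap_polytope d c \<longleftrightarrow>
    u \<in> interior_funs 0 d \<and> (\<forall>i\<in>{0<..<d} \<times> UNIV. 0 \<le> slack c u i)"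
  by (auto simp: lap_polytope_def slack_def split: if_splits)

lemma slack_add_scale:
  "slack c (\<lambda>j. u j + t * v j) i = slack c u i + t * slack 0 v i"
  by (auto simp: slack_def lap_def algebra_simps split: prod.split)

lemma lap_polytope_move:
  fixes u v :: "nat \<Rightarrow> real"
  assumes u: "u \<in> lap_polytope d c" and v: "v \<in> interior_funs 0 d"
    and tight: "\<And>i. i \<in> {0<..<d} \<times> UNIV \<Longrightarrow> slack c u i = 0 \<Longrightarrow> slack 0 v i = 0"
    and neg: "j \<in> {0<..<d} \<times> UNIV" "slack 0 v j < 0"
  obtains t where "0 < t" "(\<lambda>j. u j + t * v j) \<in> lap_polytope d c"
    "card {i \<in> {0<..<d} \<times> UNIV. slack c (\<lambda>j. u j + t * v j) i \<noteq> 0} <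
      card {i \<in> {0<..<d} \<times> UNIV. slack c u i \<noteq> 0}"
proof -
  obtain t where t: "0 < t" "\<And>i. i \<in> {0<..<d} \<times> UNIV \<Longrightarrow> 0 \<le> slack c u i + t * slack 0 v i"
    "card {i \<in> {0<..<d} \<times> UNIV. slack c u i + t * slack 0 v i \<noteq> 0} <
      card {i \<in> {0<..<d} \<times> UNIV. slack c u i \<noteq> 0}"
  proof (rule affine_move[of "{0<..<d} \<times> (UNIV :: bool set)" "slack c u" "slack 0 v" j])
    show "0 \<le> slack c u i" if "i \<in> {0<..<d} \<times> UNIV" for i
      using u that unfolding lap_polytope_slack by blast
  qed (use tight neg in auto)
  moreover have "(\<lambda>j. u j + t * v j) \<in> interior_funs 0 d"
    using u v by (simp add: lap_polytope_def interior_funs_def)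
  ultimately show ?thesis
    using that[of t] by (simp add: lap_polytope_slack slack_add_scale)
qed

text \<open>The tent with support \<open>{l<..<r}\<close> and apex \<open>k\<close>: adding a multiple of it to \<open>u\<close> disturbs no tight
  constraint when \<open>l\<close> and \<open>r\<close> are the zeros of \<open>u\<close> nearest to \<open>k\<close>.\<close>

definition hat :: "nat \<Rightarrow> nat \<Rightarrow> nat \<Rightarrow> nat \<Rightarrow> real" where
  "hat l k r j = (if l < j \<and> j \<le> k then (real j - real l) * (real r - real k)
     else if k < j \<and> j < r then (real r - real j) * (real k - real l) else 0)"

text \<open>The tent rises with slope \<open>r - k\<close> and falls with slope
  \<open>k - l\<close>, so its kink at \<open>k\<close> is their sum; its only other kinks are at
  \<open>l\<close> and \<open>r\<close>.\<close>

lemma lap_hat: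
  assumes "l < k" "k < r" "0 < j"
  shows "j = k \<Longrightarrow> lap (hat l k r) j = real r - real l"
    and "j \<noteq> k \<Longrightarrow> j \<noteq> l \<Longrightarrow> j \<noteq> r \<Longrightarrow> lap (hat l k r) j = 0"
proof -
  have j: "real (j - 1) = real j - 1" using assms by auto
  show "lap (hat l k r) j = real r - real l" if "j = k"
  proof -
    have "hat l k r (j - 1) = (real j - 1 - real l) * (real r - real k)"
      using assms that j by (cases "l < j - 1") (auto simp: hat_def)
    moreover have "hat l k r (j + 1) = (real r - real j - 1) * (real k - real l)"
      using assms that by (cases "j + 1 < r") (auto simp: hat_def)
    moreover have "hat l k r j = (real j - real l) * (real r - real k)"
      using assms that by (simp add: hat_def)
    ultimately show ?thesis using that by (simp add: lap_def algebra_simps)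
  qed
  show "lap (hat l k r) j = 0" if ne: "j \<noteq> k" "j \<noteq> l" "j \<noteq> r"
  proof -
    consider "j < l" | "l < j" "j < k" | "k < j" "j < r" | "r < j" using ne by linarith
    then show ?thesis
    proof cases
      case 1
      then show ?thesis using assms by (simp add: lap_def hat_def)
    next
      case 2
      have "hat l k r (j - 1) = (real j - 1 - real l) * (real r - real k)"
        using assms 2 j by (cases "l < j - 1") (auto simp: hat_def)
      moreover have "hat l k r (j + 1) = (real j + 1 - real l) * (real r - real k)"
        using assms 2 by (simp add: hat_def)
      moreover have "hat l k r j = (real j - real l) * (real r - real k)"
        using assms 2 by (simp add: hat_def)
      ultimately show ?thesis by (simp add: lap_def algebra_simps)
    next
      case 3
      have "hat l k r (j - 1) = (real r - real j + 1) * (real k - real l)"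
      proof (cases "k < j - 1")
        case True
        then show ?thesis using assms 3 j by (simp add: hat_def)
      next
        case False
        then have "j = k + 1" using 3 by simp
        then show ?thesis using assms by (simp add: hat_def algebra_simps)
      qed
      moreover have "hat l k r (j + 1) = (real r - real j - 1) * (real k - real l)"
        using assms 3 by (cases "j + 1 < r") (auto simp: hat_def)
      moreover have "hat l k r j = (real r - real j) * (real k - real l)"
        using assms 3 by (simp add: hat_def)
      ultimately show ?thesis by (simp add: lap_def algebra_simps)
    next
      case 4
      then have "hat l k r (j - 1) = 0" using assms unfolding hat_def by (intro if_not_P[THEN trans]) auto
      then show ?thesis using assms 4 by (simp add: lap_def hat_def)
    qed
  qed
qed

lemma nearest_zeros:
  fixes u :: "nat \<Rightarrow> real"
  assumes "u \<in> interior_funs 0 d" "0 < u k"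
  obtains l r where "l < k" "k < r" "r \<le> d" "u l = 0" "u r = 0" "\<And>j. l < j \<Longrightarrow> j < r \<Longrightarrow> u j \<noteq> 0"
proof -
  have "k \<in> {0<..<d}"
  proof (rule ccontr)
    assume "k \<notin> {0<..<d}"
    then have "u k = 0" using assms(1) unfolding interior_funs_def by blast
    with assms(2) show False by simp
  qed
  then have k: "0 < k" "k < d" by auto
  have zero: "u 0 = 0" "u d = 0" using assms(1) by (auto simp: interior_funs_def)
  define l where "l = (GREATEST j. j < k \<and> u j = 0)"
  define r where "r = (LEAST j. k < j \<and> u j = 0)"
  have l: "l < k \<and> u l = 0"
    unfolding l_def by (rule GreatestI_nat[of _ 0 k]) (use k zero in auto)
  have lmax: "j \<le> l" if "j < k" "u j = 0" for j
    unfolding l_def by (rule Greatest_le_nat[of _ j k]) (use that in auto)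
  have r: "k < r \<and> u r = 0"
    unfolding r_def by (rule LeastI[of _ d]) (use k zero in auto)
  have rmin: "r \<le> j" if "k < j" "u j = 0" for j
    unfolding r_def by (rule Least_le) (use that in auto)
  have nz: "u j \<noteq> 0" if "l < j" "j < r" for j
    using lmax[of j] rmin[of j] that assms(2) by (cases j k rule: linorder_cases) auto
  show ?thesis
    by (rule that[of l r]) (use l r rmin[of d] k zero nz in auto)
qed

text \<open>With both constraints at \<open>k\<close> slack, one can move along the tent in either
  direction until a further constraint becomes tight: upwards \<open>lap u k\<close> grows,
  downwards \<open>u k\<close> shrinks. So \<open>u\<close> lies between two points with fewer slack
  constraints.\<close>

lemma lap_polytope_vertex_or_segment:
  fixes u :: "nat \<Rightarrow> real"
  assumes u: "u \<in> lap_polytope d c" and c: "0 \<le> c"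
    and k: "k \<in> {0<..<d}" "u k \<noteq> 0" "lap u k \<noteq> c"
  obtains u1 u2 t where "u1 \<in> lap_polytope d c" "u2 \<in> lap_polytope d c" "0 \<le> t" "t \<le> 1"
    "u = (\<lambda>j. t * u1 j + (1 - t) * u2 j)"
    "card {i \<in> {0<..<d} \<times> UNIV. slack c u1 i \<noteq> 0} < card {i \<in> {0<..<d} \<times> UNIV. slack c u i \<noteq> 0}"
    "card {i \<in> {0<..<d} \<times> UNIV. slack c u2 i \<noteq> 0} < card {i \<in> {0<..<d} \<times> UNIV. slack c u i \<noteq> 0}"
proof -
  have V: "u \<in> interior_funs 0 d" using u by (simp add: lap_polytope_def)
  have u_nonneg: "0 \<le> u j" for j
  proof (cases "j \<in> {0<..<d}")
    case True
    then show ?thesis using u unfolding lap_polytope_def by blast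
  next
    case False
    then have "u j = 0" using V unfolding interior_funs_def by blast
    then show ?thesis by simp
  qed
  have "0 < u k" using k(2) u_nonneg[of k] by simp
  then obtain l r where lr: "l < k" "k < r" "r \<le> d" "u l = 0" "u r = 0"
    and pos: "\<And>j. l < j \<Longrightarrow> j < r \<Longrightarrow> u j \<noteq> 0"
    by (rule nearest_zeros[OF V]) blast
  have hatV: "hat l k r \<in> interior_funs 0 d"
    using lr by (simp add: interior_funs_def hat_def)
  \<comment> \<open>At a zero beside a nonzero value \<open>lap u\<close> is negative. Hence the
    upper constraint is slack at \<open>l\<close> and \<open>r\<close>, the only places besides
    \<open>k\<close> where the tent has a kink.\<close>
  have notch: "lap u z < c" if "0 < z" "u z = 0" "u (z + 1) \<noteq> 0 \<or> u (z - 1) \<noteq> 0" for z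
    using that u_nonneg[of "z + 1"] u_nonneg[of "z - 1"] c by (auto simp: lap_def)
  have tight: "slack 0 (hat l k r) i = 0" if i: "i \<in> {0<..<d} \<times> UNIV" and z: "slack c u i = 0" for i
  proof (cases i)
    case (Pair j lower)
    show ?thesis
    proof (cases lower)
      case True
      then have "u j = 0" using z Pair by (simp add: slack_def)
      then have "\<not> (l < j \<and> j < r)" using pos by blast
      then show ?thesis using True Pair lr by (auto simp: slack_def hat_def)
    next
      case False
      then have lap: "lap u j = c" using z Pair by (simp add: slack_def)
      have j: "0 < j" using i Pair by simp
      have "j \<noteq> l" using notch[of j] lap j lr pos[of "l + 1"] by auto
      moreover have "j \<noteq> r" using notch[of j] lap j lr pos[of "r - 1"] by auto
      moreover have "j \<noteq> k" using lap k(3) by blast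
      ultimately show ?thesis using lap_hat(2)[OF lr(1,2) j] False Pair by (simp add: slack_def)
    qed
  qed
  have neg1: "slack 0 (hat l k r) (k, False) < 0"
    using lap_hat(1)[OF lr(1,2), of k] lr by (simp add: slack_def)
  have neg2: "slack 0 (\<lambda>j. - hat l k r j) (k, True) < 0"
    using lr by (simp add: slack_def hat_def)
  have minus: "slack 0 (\<lambda>j. - hat l k r j) i = - slack 0 (hat l k r) i" for i
    by (auto simp: slack_def lap_def split: prod.split)
  obtain t where t: "0 < t" "(\<lambda>j. u j + t * hat l k r j) \<in> lap_polytope d c"
    "card {i \<in> {0<..<d} \<times> UNIV. slack c (\<lambda>j. u j + t * hat l k r j) i \<noteq> 0} <
      card {i \<in> {0<..<d} \<times> UNIV. slack c u i \<noteq> 0}"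
    by (rule lap_polytope_move[OF u hatV tight _ neg1]) (use k in auto)
  obtain s where s: "0 < s" "(\<lambda>j. u j + s * - hat l k r j) \<in> lap_polytope d c"
    "card {i \<in> {0<..<d} \<times> UNIV. slack c (\<lambda>j. u j + s * - hat l k r j) i \<noteq> 0} <
      card {i \<in> {0<..<d} \<times> UNIV. slack c u i \<noteq> 0}"
  proof (rule lap_polytope_move[OF u _ _ _ neg2])
    show "(\<lambda>j. - hat l k r j) \<in> interior_funs 0 d" using hatV by (simp add: interior_funs_def)
    show "slack 0 (\<lambda>j. - hat l k r j) i = 0" if "i \<in> {0<..<d} \<times> UNIV" "slack c u i = 0" for i
      using tight[OF that] by (simp add: minus)
  qed (use k in auto)
  \<comment> \<open>The weights balance the two displacements:
    \<open>p * t = (1 - p) * s\<close>.\<close>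
  define p where "p = s / (s + t)"
  have p: "0 \<le> p" "p \<le> 1" "1 - p = t / (s + t)"
    using s(1) t(1) by (auto simp: p_def field_simps)
  have "u = (\<lambda>j. p * (u j + t * hat l k r j) + (1 - p) * (u j + s * - hat l k r j))"
  proof
    fix j
    have "p * t = (1 - p) * s" unfolding p(3) by (simp add: p_def)
    then have "p * (t * hat l k r j) = (1 - p) * (s * hat l k r j)"
      by (simp only: mult.assoc[symmetric])
    then show "u j = p * (u j + t * hat l k r j) + (1 - p) * (u j + s * - hat l k r j)"
      by (simp add: algebra_simps)
  qed
  from that[OF t(2) s(2) p(1,2) this t(3) s(3)] show ?thesis .
qed

section \<open>Pattern-avoiding permutations as vertices\<close>

lemma contains_132_iff:
  "contains_pattern d \<pi> [1, 3, 2] \<longleftrightarrow>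
    (\<exists>i j k. 1 \<le> i \<and> i < j \<and> j < k \<and> k \<le> d \<and> \<pi> i < \<pi> k \<and> \<pi> k < \<pi> j)" (is "?l \<longleftrightarrow> ?r")
proof
  assume ?l
  then obtain f where f: "strict_mono_on {..<3} f" "f ` {..<3} \<subseteq> {1..d}"
    "\<And>a b. a < 3 \<Longrightarrow> b < 3 \<Longrightarrow> \<pi> (f a) < \<pi> (f b) \<longleftrightarrow> [1, 3, 2] ! a < ([1, 3, 2] ! b :: nat)"
    by (auto simp: contains_pattern_def numeral_3_eq_3)
  have "f 0 < f 1" "f 1 < f 2" using strict_mono_onD[OF f(1)] by auto
  moreover have "f 0 \<in> {1..d}" "f 2 \<in> {1..d}" using f(2) unfolding image_subset_iff by simp_all
  moreover have "\<pi> (f 0) < \<pi> (f 2)" "\<pi> (f 2) < \<pi> (f 1)" using f(3) by auto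
  ultimately show ?r by (intro exI[of _ "f 0"] exI[of _ "f 1"] exI[of _ "f 2"]) auto
next
  assume ?r
  then obtain i j k where ijk: "1 \<le> i" "i < j" "j < k" "k \<le> d" "\<pi> i < \<pi> k" "\<pi> k < \<pi> j" by blast
  then show ?l unfolding contains_pattern_def
    by (intro exI[of _ "\<lambda>a. [i, j, k] ! a"]) (auto simp: strict_mono_on_def less_Suc_eq)
qed

lemma contains_213_iff:
  "contains_pattern d \<pi> [2, 1, 3] \<longleftrightarrow>
    (\<exists>i j k. 1 \<le> i \<and> i < j \<and> j < k \<and> k \<le> d \<and> \<pi> j < \<pi> i \<and> \<pi> i < \<pi> k)" (is "?l \<longleftrightarrow> ?r")
proof
  assume ?l
  then obtain f where f: "strict_mono_on {..<3} f" "f ` {..<3} \<subseteq> {1..d}"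
    "\<And>a b. a < 3 \<Longrightarrow> b < 3 \<Longrightarrow> \<pi> (f a) < \<pi> (f b) \<longleftrightarrow> [2, 1, 3] ! a < ([2, 1, 3] ! b :: nat)"
    by (auto simp: contains_pattern_def numeral_3_eq_3)
  have "f 0 < f 1" "f 1 < f 2" using strict_mono_onD[OF f(1)] by auto
  moreover have "f 0 \<in> {1..d}" "f 2 \<in> {1..d}" using f(2) unfolding image_subset_iff by simp_all
  moreover have "\<pi> (f 1) < \<pi> (f 0)" "\<pi> (f 0) < \<pi> (f 2)" using f(3) by auto
  ultimately show ?r by (intro exI[of _ "f 0"] exI[of _ "f 1"] exI[of _ "f 2"]) auto
next
  assume ?r
  then obtain i j k where ijk: "1 \<le> i" "i < j" "j < k" "k \<le> d" "\<pi> j < \<pi> i" "\<pi> i < \<pi> k" by blast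
  then show ?l unfolding contains_pattern_def
    by (intro exI[of _ "\<lambda>a. [i, j, k] ! a"]) (auto simp: strict_mono_on_def less_Suc_eq)
qed

text \<open>The smallest of \<open>k\<close> distinct values in \<open>{1..d}\<close> is at most
  \<open>d + 1 - k\<close>; induction removes it.\<close>

lemma sum_le_sum_top:
  assumes "finite B" "B \<subseteq> {1..d}"
  shows "(\<Sum>b\<in>B. real b) \<le> (\<Sum>i=1..card B. real d + 1 - real i)"
  using assms
proof (induction "card B" arbitrary: B)
  case (Suc k)
  define b where "b = Min B"
  have b: "b \<in> B" unfolding b_def using Suc by (intro Min_in) auto
  have "b \<le> x" if "x \<in> B" for x using that Suc.prems(1) by (simp add: b_def)
  then have "B \<subseteq> {b..d}" using Suc.prems(2) by auto
  then have "card B \<le> card {b..d}" by (intro card_mono) auto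
  moreover have "b \<le> d" using b Suc.prems(2) by auto
  ultimately have bk: "real b \<le> real d + 1 - real (Suc k)" using Suc.hyps(2) by simp
  have k: "k = card (B - {b})" using Suc.hyps(2) Suc.prems(1) b by simp
  have "(\<Sum>x\<in>B. real x) = real b + (\<Sum>x\<in>B - {b}. real x)"
    using Suc.prems(1) b by (rule sum.remove)
  also have "(\<Sum>x\<in>B - {b}. real x) \<le> (\<Sum>i=1..k. real d + 1 - real i)"
    using Suc.hyps(1)[OF k] Suc.prems k by auto
  finally have "(\<Sum>x\<in>B. real x) \<le> (real d + 1 - real (Suc k)) + (\<Sum>i=1..k. real d + 1 - real i)"
    using bk by simp
  then show ?case by (simp add: Suc.hyps(2)[symmetric])
qed simp

text \<open>Known as the reverse layered permutations: increasing runs of consecutive values, each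
  run lying below the one before it.\<close>

definition layered_perms :: "nat \<Rightarrow> (nat \<Rightarrow> nat) set" where
  "layered_perms d = {\<pi>. \<pi> permutes {1..d} \<and> \<not> contains_pattern d \<pi> [1, 3, 2]
    \<and> \<not> contains_pattern d \<pi> [2, 1, 3]}"

text \<open>If an ascent skips the value \<open>\<pi> k + 1\<close>, that value sits elsewhere:
  before position \<open>k\<close> it completes a 213, after position \<open>k + 1\<close> a
  132.\<close>

lemma layered_perms_ascent:
  assumes \<pi>: "\<pi> \<in> layered_perms d" and k: "k \<in> {0<..<d}"
  shows "\<pi> (k + 1) \<le> \<pi> k + 1"
proof (rule ccontr)
  assume "\<not> \<pi> (k + 1) \<le> \<pi> k + 1"
  then have big: "\<pi> k + 1 < \<pi> (k + 1)" by simp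
  have perm: "\<pi> permutes {1..d}" using \<pi> by (simp add: layered_perms_def)
  have "\<pi> k \<in> {1..d}" "\<pi> (k + 1) \<in> {1..d}"
    using k by (simp_all only: permutes_in_image[OF perm]) auto
  then have "\<pi> k + 1 \<in> {1..d}" using big by auto
  then have "\<pi> k + 1 \<in> \<pi> ` {1..d}" using permutes_image[OF perm] by simp
  then obtain j where j: "j \<in> {1..d}" "\<pi> j = \<pi> k + 1" by (metis imageE)
  then have "j \<noteq> k" "j \<noteq> k + 1" using big by auto
  then consider "j < k" | "k + 1 < j" by linarith
  then show False
  proof cases
    case 1
    then have "contains_pattern d \<pi> [2, 1, 3]" unfolding contains_213_iff
      using j big k by (intro exI[of _ j] exI[of _ k] exI[of _ "k + 1"]) auto
    with \<pi> show False by (simp add: layered_perms_def)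
  next
    case 2
    then have "contains_pattern d \<pi> [1, 3, 2]" unfolding contains_132_iff
      using j big k by (intro exI[of _ k] exI[of _ "k + 1"] exI[of _ j]) auto
    with \<pi> show False by (simp add: layered_perms_def)
  qed
qed

text \<open>Nonnegativity holds because \<open>k\<close> distinct values never exceed the sum of the
  \<open>k\<close> largest, and \<open>lap u k\<close> equals 1 + \<pi>(k+1) - \<pi>(k), so its
  bound 2 is the ascent bound.\<close>

lemma perm_point_in_image:
  assumes \<pi>: "\<pi> \<in> layered_perms d"
  shows "perm_point d \<pi> \<in> diff_point d (\<lambda>i. real d + 1 - real i) (- 1) ` lap_polytope d 2"
proof -
  have perm: "\<pi> permutes {1..d}" using \<pi> by (simp add: layered_perms_def)
  define u where "u k = (if k \<le> d then (\<Sum>i=1..k. real d + 1 - real i - real (\<pi> i)) else 0)" for k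
  have step: "u (Suc k) - u k = real d - real k - real (\<pi> (Suc k))" if "Suc k \<le> d" for k
    using that by (simp add: u_def)
  have "u d = 0"
  proof -
    have "(\<Sum>i=1..d. real (\<pi> i)) = (\<Sum>i=1..d. real i)"
      using sum.permute[OF perm, of real] by (simp add: o_def)
    also have "\<dots> = (\<Sum>i=1..d. real (d + 1 - i))"
      by (rule sum.atLeastAtMost_rev)
    also have "\<dots> = (\<Sum>i=1..d. real d + 1 - real i)"
      by (rule sum.cong) auto
    finally show ?thesis by (simp add: u_def sum_subtractf)
  qed
  then have V: "u \<in> interior_funs 0 d"
    by (auto simp: interior_funs_def u_def not_less le_less)
  have "0 \<le> u k \<and> lap u k \<le> 2" if k: "k \<in> {0<..<d}" for k
  proof
    have inj: "inj_on \<pi> {1..k}" using permutes_inj_on[OF perm] .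
    have "(\<Sum>b\<in>\<pi> ` {1..k}. real b) \<le> (\<Sum>i=1..card (\<pi> ` {1..k}). real d + 1 - real i)"
    proof (rule sum_le_sum_top)
      have "\<pi> ` {1..k} \<subseteq> \<pi> ` {1..d}" using k by (intro image_mono) auto
      then show "\<pi> ` {1..k} \<subseteq> {1..d}" using permutes_image[OF perm] by simp
    qed simp
    then show "0 \<le> u k" using k inj by (simp add: u_def sum.reindex card_image sum_subtractf)
    obtain k' where k': "k = Suc k'" using k by (cases k) auto
    have "lap u k = 1 + real (\<pi> (k + 1)) - real (\<pi> k)"
      using step[of k] step[of k'] k k' by (simp add: lap_def)
    then show "lap u k \<le> 2" using layered_perms_ascent[OF \<pi> k] by linarith
  qed
  with V have "u \<in> lap_polytope d 2" by (simp add: lap_polytope_def)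
  moreover have "perm_point d \<pi> = diff_point d (\<lambda>i. real d + 1 - real i) (- 1) u"
  proof
    fix i
    show "perm_point d \<pi> i = diff_point d (\<lambda>i. real d + 1 - real i) (- 1) u i"
    proof (cases "i \<in> {1..d}")
      case True
      then show ?thesis using step[of "i - 1"] by (simp add: perm_point_def diff_point_def)
    next
      case False
      then show ?thesis unfolding perm_point_def diff_point_def by (simp only: if_False)
    qed
  qed
  ultimately show ?thesis by blast
qed

text \<open>A sequence with second difference -2 that starts at 0 is determined by its first
  increment, here \<open>c\<close>, and the zero at \<open>r\<close> determines that
  increment.\<close>

lemma block_formula:
  fixes u :: "nat \<Rightarrow> real"
  assumes "l < r" "u l = 0" "u r = 0" and lap: "\<And>j. l < j \<Longrightarrow> j < r \<Longrightarrow> lap u j = 2"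
    and j: "j \<le> r - l"
  shows "u (l + j) = real j * (real (r - l) - real j)"
proof -
  define c where "c = u (l + 1)"
  \<comment> \<open>The recurrence has order 2, so the induction carries two neighbouring values,
    the second only while it stays in the block.\<close>
  have *: "u (l + j) = real j * c - real j * (real j - 1) \<and>
      (j + 1 \<le> r - l \<longrightarrow> u (l + j + 1) = real (j + 1) * c - real (j + 1) * real j)"
    if "j \<le> r - l" for j
    using that
  proof (induction j)
    case (Suc j)
    have "lap u (l + j + 1) = 2" if "j + 2 \<le> r - l" by (rule lap) (use that in auto)
    with Suc show ?case by (auto simp: lap_def algebra_simps)
  qed (use assms in \<open>simp add: c_def\<close>)
  have "real (r - l) * c - real (r - l) * (real (r - l) - 1) = 0"
    using *[of "r - l"] assms(1,3) by simp
  then have "real (r - l) * (c - (real (r - l) - 1)) = 0" by (simp add: right_diff_distrib)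
  then have "c = real (r - l) - 1" using assms(1) by simp
  with *[OF j] show ?thesis by (simp add: algebra_simps)
qed

text \<open>Between consecutive zeros \<open>l < r\<close> of a vertex, \<open>u\<close> is the parabola \<open>(k - l) (r - k)\<close>, which corresponds
  to a block of \<open>r - l\<close> consecutive increasing values.\<close>

lemma vertex_is_perm_point:
  fixes u :: "nat \<Rightarrow> real"
  assumes u: "u \<in> lap_polytope d 2"
    and vertex: "\<And>k. k \<in> {0<..<d} \<Longrightarrow> u k = 0 \<or> lap u k = 2"
  shows "diff_point d (\<lambda>i. real d + 1 - real i) (- 1) u \<in> perm_point d ` layered_perms d"
proof -
  have zero: "u 0 = 0" "u d = 0" using u by (auto simp: lap_polytope_def interior_funs_def)
  \<comment> \<open>Coordinate \<open>i\<close> is the increment from \<open>u (i - 1)\<close> to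
    \<open>u i\<close>. Its block therefore runs from the last zero strictly before \<open>i\<close>
    to the first zero at or after \<open>i\<close>.\<close>
  define l where "l i = (GREATEST z. z < i \<and> u z = 0)" for i
  define r where "r i = (LEAST z. i \<le> z \<and> u z = 0)" for i
  have l: "l i < i" "u (l i) = 0" if "i \<in> {1..d}" for i
    using GreatestI_nat[of "\<lambda>z. z < i \<and> u z = 0" 0 i] zero that by (auto simp: l_def)
  have lmax: "z \<le> l i" if "z < i" "u z = 0" for i z
    unfolding l_def by (rule Greatest_le_nat[of _ z i]) (use that in auto)
  have r: "i \<le> r i" "u (r i) = 0" if "i \<in> {1..d}" for i
    using LeastI[of "\<lambda>z. i \<le> z \<and> u z = 0" d] zero that by (auto simp: r_def)
  have rmin: "r i \<le> z" if "i \<le> z" "u z = 0" for i z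
    unfolding r_def by (rule Least_le) (use that in auto)
  have rd: "r i \<le> d" if "i \<in> {1..d}" for i using rmin[of i d] zero that by simp
  \<comment> \<open>Later blocks receive smaller values: the positions \<open>l + 1, ..., r\<close>
    of a block take the values \<open>d - r + 1, ..., d - l\<close> in increasing order.\<close>
  define \<pi> where "\<pi> i = (if i \<in> {1..d} then (d - r i) + (i - l i) else i)" for i
  have \<pi>_eq: "\<pi> i = (d - r i) + (i - l i)" if "i \<in> {1..d}" for i using that by (simp add: \<pi>_def)
  have order: "(\<forall>z. i \<le> z \<and> z < j \<longrightarrow> u z \<noteq> 0) \<and> \<pi> i < \<pi> j \<or>
      (\<exists>z. i \<le> z \<and> z < j \<and> u z = 0) \<and> \<pi> j < \<pi> i"
    if ij: "i \<in> {1..d}" "j \<in> {1..d}" "i < j" for i j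
  proof (cases "\<exists>z. i \<le> z \<and> z < j \<and> u z = 0")
    case True
    then obtain z where z: "i \<le> z" "z < j" "u z = 0" by blast
    have "r i \<le> l j" using rmin[of i z] lmax[of z j] z by simp
    then have "\<pi> j < \<pi> i"
      using l(1)[OF ij(1)] l(1)[OF ij(2)] r(1)[OF ij(1)] r(1)[OF ij(2)] rd[OF ij(1)] rd[OF ij(2)]
      unfolding \<pi>_eq[OF ij(1)] \<pi>_eq[OF ij(2)] by linarith
    with True show ?thesis by blast
  next
    case False
    have "l j < i" using False l[OF ij(2)] by (meson not_le)
    then have "l j = l i" using lmax[of "l j" i] lmax[of "l i" j] l[OF ij(1)] l[OF ij(2)] ij(3) by simp
    moreover have "j \<le> r i" using False r[OF ij(1)] by (meson not_le)
    then have "r j = r i" using rmin[of j "r i"] rmin[of i "r j"] r[OF ij(1)] r[OF ij(2)] ij(3) by simp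
    ultimately have "\<pi> i < \<pi> j"
      using ij(3) \<open>l j < i\<close> unfolding \<pi>_eq[OF ij(1)] \<pi>_eq[OF ij(2)] by simp
    with False show ?thesis by blast
  qed
  have "\<pi> permutes {1..d}"
  proof (rule bij_imp_permutes)
    have "inj_on \<pi> {1..d}"
    proof (rule inj_onI)
      fix i j assume ij: "i \<in> {1..d}" "j \<in> {1..d}" "\<pi> i = \<pi> j"
      show "i = j"
        using order[OF ij(1,2)] order[OF ij(2,1)] ij(3) by (cases i j rule: linorder_cases) auto
    qed
    moreover have "\<pi> i \<in> {1..d}" if i: "i \<in> {1..d}" for i
      using l(1)[OF i] r(1)[OF i] rd[OF i]
      unfolding \<pi>_eq[OF i] atLeastAtMost_iff by (intro conjI; linarith)
    then have "\<pi> ` {1..d} \<subseteq> {1..d}" by blast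
    ultimately show "bij_betw \<pi> {1..d} {1..d}"
      using endo_inj_surj[of "{1..d}" \<pi>] by (simp add: bij_betw_def)
  qed (auto simp: \<pi>_def)
  moreover have "\<not> contains_pattern d \<pi> [1, 3, 2]"
  proof
    assume "contains_pattern d \<pi> [1, 3, 2]"
    then obtain i j k where ijk: "1 \<le> i" "i < j" "j < k" "k \<le> d" "\<pi> i < \<pi> k" "\<pi> k < \<pi> j"
      unfolding contains_132_iff by blast
    \<comment> \<open>\<open>\<pi> i < \<pi> k\<close> puts \<open>i\<close>, \<open>j\<close> and
      \<open>k\<close> into one block, where \<open>\<pi>\<close> increases.\<close>
    then have "\<forall>z. i \<le> z \<and> z < k \<longrightarrow> u z \<noteq> 0" using order[of i k] by auto
    with ijk show False using order[of j k] by auto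
  qed
  moreover have "\<not> contains_pattern d \<pi> [2, 1, 3]"
  proof
    assume "contains_pattern d \<pi> [2, 1, 3]"
    then obtain i j k where ijk: "1 \<le> i" "i < j" "j < k" "k \<le> d" "\<pi> j < \<pi> i" "\<pi> i < \<pi> k"
      unfolding contains_213_iff by blast
    then have "\<forall>z. i \<le> z \<and> z < k \<longrightarrow> u z \<noteq> 0" using order[of i k] by auto
    with ijk show False using order[of i j] by auto
  qed
  ultimately have "\<pi> \<in> layered_perms d" by (simp add: layered_perms_def)
  moreover have "diff_point d (\<lambda>i. real d + 1 - real i) (- 1) u = perm_point d \<pi>"
  proof
    fix i
    show "diff_point d (\<lambda>i. real d + 1 - real i) (- 1) u i = perm_point d \<pi> i"
    proof (cases "i \<in> {1..d}")
      case i: True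
      define j where "j = i - l i"
      have ij: "i = l i + j" "i - 1 = l i + (j - 1)" "0 < j" "j \<le> r i - l i"
        using l(1)[OF i] r(1)[OF i] by (auto simp: j_def)
      have lap: "lap u z = 2" if z: "l i < z" "z < r i" for z
      proof -
        have "u z \<noteq> 0" using lmax[of z i] rmin[of i z] z by (cases "z < i") auto
        then show ?thesis using vertex[of z] z rd[OF i] by auto
      qed
      have block: "u (l i + k) = real k * (real (r i - l i) - real k)" if "k \<le> r i - l i" for k
        by (rule block_formula) (use l[OF i] r[OF i] lap that in auto)
      have "u i - u (i - 1) = real (r i - l i) - 2 * real j + 1"
      proof -
        have "u i = real j * (real (r i - l i) - real j)" using block[OF ij(4)] ij(1) by simp
        moreover have "u (i - 1) = real (j - 1) * (real (r i - l i) - real (j - 1))"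
          using block[of "j - 1"] ij(2,4) by simp
        moreover have "real (j - 1) = real j - 1" using ij(3) by simp
        ultimately show ?thesis by (simp only: algebra_simps)
      qed
      then show ?thesis
        using i l(1)[OF i] r(1)[OF i] rd[OF i]
        by (simp add: diff_point_def perm_point_def \<pi>_eq[OF i] j_def)
    next
      case False
      then show ?thesis unfolding perm_point_def diff_point_def by (simp only: if_False)
    qed
  qed
  ultimately show ?thesis by blast
qed

lemma diff_point_convex_combination:
  assumes "s + t = 1"
  shows "diff_point d \<beta> \<sigma> (\<lambda>j. s * u j + t * v j) = s *\<^sub>R diff_point d \<beta> \<sigma> u + t *\<^sub>R diff_point d \<beta> \<sigma> v"
proof
  fix i
  have "\<beta> i = s * \<beta> i + t * \<beta> i" using assms by (simp flip: distrib_right)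
  then show "diff_point d \<beta> \<sigma> (\<lambda>j. s * u j + t * v j) i =
      (s *\<^sub>R diff_point d \<beta> \<sigma> u + t *\<^sub>R diff_point d \<beta> \<sigma> v) i"
    by (simp add: diff_point_def scaleR_fun_def algebra_simps)
qed

lemma convex_diff_point_lap_polytope: "convex (diff_point d \<beta> \<sigma> ` lap_polytope d c)"
proof (rule convexI)
  fix x y and s t :: real
  assume "x \<in> diff_point d \<beta> \<sigma> ` lap_polytope d c" "y \<in> diff_point d \<beta> \<sigma> ` lap_polytope d c"
    and st: "0 \<le> s" "0 \<le> t" "s + t = 1"
  then obtain u v where uv: "u \<in> lap_polytope d c" "v \<in> lap_polytope d c"
    "x = diff_point d \<beta> \<sigma> u" "y = diff_point d \<beta> \<sigma> v" by blast
  define w where "w j = s * u j + t * v j" for j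
  have "lap w k \<le> c" if k: "k \<in> {0<..<d}" for k
  proof -
    have "lap w k = s * lap u k + t * lap v k" by (simp add: w_def lap_def algebra_simps)
    also have "\<dots> \<le> c" using uv k st by (intro convex_bound_le) (auto simp: lap_polytope_def)
    finally show ?thesis .
  qed
  moreover have "0 \<le> w k" if "k \<in> {0<..<d}" for k
    using uv(1,2) that st by (simp add: w_def lap_polytope_def)
  moreover have "w \<in> interior_funs 0 d"
    using uv(1,2) by (simp add: w_def lap_polytope_def interior_funs_def)
  ultimately have "w \<in> lap_polytope d c" by (simp add: lap_polytope_def)
  moreover have "diff_point d \<beta> \<sigma> w = s *\<^sub>R x + t *\<^sub>R y"
    unfolding w_def uv(3,4) by (rule diff_point_convex_combination[OF st(3)])
  ultimately show "s *\<^sub>R x + t *\<^sub>R y \<in> diff_point d \<beta> \<sigma> ` lap_polytope d c"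
    by (metis imageI)
qed

text \<open>Minkowski's theorem for this polytope, by induction on the number of slack constraints:
  a point with both constraints slack at some \<open>k\<close> lies on a segment between points with
  fewer, and without such \<open>k\<close> it is a permutation point. Conversely, the image is
  convex and contains all permutation points.\<close>

lemma P_132_213_eq:
  "P_132_213 d = diff_point d (\<lambda>i. real d + 1 - real i) (- 1) ` lap_polytope d 2"
proof -
  let ?D = "diff_point d (\<lambda>i. real d + 1 - real i) (- 1)"
  let ?I = "{0<..<d} \<times> (UNIV :: bool set)"
  have P: "P_132_213 d = convex hull (perm_point d ` layered_perms d)"
    by (simp add: P_132_213_def layered_perms_def)
  have "?D u \<in> convex hull (perm_point d ` layered_perms d)" if "u \<in> lap_polytope d 2" for u
    using that
  proof (induction "card {i \<in> ?I. slack 2 u i \<noteq> 0}" arbitrary: u rule: less_induct)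
    case (less u)
    show ?case
    proof (cases "\<exists>k\<in>{0<..<d}. u k \<noteq> 0 \<and> lap u k \<noteq> 2")
      case False
      then have "?D u \<in> perm_point d ` layered_perms d"
        by (intro vertex_is_perm_point less.prems) blast
      then show ?thesis by (rule hull_inc)
    next
      case True
      then obtain k where k: "k \<in> {0<..<d}" "u k \<noteq> 0" "lap u k \<noteq> 2" by blast
      obtain u1 u2 t where seg: "u1 \<in> lap_polytope d 2" "u2 \<in> lap_polytope d 2" "0 \<le> t" "t \<le> 1"
        "u = (\<lambda>j. t * u1 j + (1 - t) * u2 j)"
        "card {i \<in> ?I. slack 2 u1 i \<noteq> 0} < card {i \<in> ?I. slack 2 u i \<noteq> 0}"
        "card {i \<in> ?I. slack 2 u2 i \<noteq> 0} < card {i \<in> ?I. slack 2 u i \<noteq> 0}"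
        by (rule lap_polytope_vertex_or_segment[OF less.prems _ k]) auto
      have "?D u = t *\<^sub>R ?D u1 + (1 - t) *\<^sub>R ?D u2"
        unfolding seg(5) by (rule diff_point_convex_combination) simp
      also have "\<dots> \<in> convex hull (perm_point d ` layered_perms d)"
        by (rule convexD[OF convex_convex_hull less.hyps[OF seg(6,1)] less.hyps[OF seg(7,2)]])
          (use seg(3,4) in auto)
      finally show ?thesis .
    qed
  qed
  moreover have "convex hull (perm_point d ` layered_perms d) \<subseteq> ?D ` lap_polytope d 2"
    by (rule hull_minimal) (use perm_point_in_image convex_diff_point_lap_polytope in auto)
  ultimately show ?thesis unfolding P by blast
qed

text \<open>Monotonicity can be tested on neighbouring coordinates, where it reads
  \<open>lap u k \<le> 1\<close>.\<close>

lemma R_polytope_eq: "R_polytope d = diff_point d (\<lambda>i. real i - 1) 1 ` lap_polytope d 1"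
proof (intro equalityI subsetI)
  fix a assume a: "a \<in> R_polytope d"
  \<comment> \<open>The value 0 prescribed at \<open>d\<close> agrees with the partial-sum formula
    because the total is fixed; this is \<open>u_le\<close>.\<close>
  define u where "u k = (if k < d then (\<Sum>i=1..k. a i) - real (k choose 2) else 0)" for k
  have u_le: "u k = (\<Sum>i=1..k. a i) - real (k choose 2)" if "k \<le> d" for k
    using a that by (cases "k = d") (auto simp: u_def R_polytope_def)
  have step: "u (Suc k) - u k = a (Suc k) - real k" if "Suc k \<le> d" for k
    using that by (simp add: u_le choose_two_Suc)
  have "u \<in> interior_funs 0 d" by (auto simp: interior_funs_def u_def)
  moreover have "0 \<le> u k" if "k \<in> {0<..<d}" for k
    using a that by (simp add: u_def R_polytope_def)
  moreover have "lap u k \<le> 1" if k: "k \<in> {0<..<d}" for k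
  proof -
    obtain k' where k': "k = Suc k'" using k by (cases k) auto
    have "a k \<le> a (Suc k)" using a k by (auto simp: R_polytope_def intro: mono_onD)
    then show ?thesis using step[of k] step[of k'] k k' by (simp add: lap_def)
  qed
  ultimately have "u \<in> lap_polytope d 1" by (simp add: lap_polytope_def)
  moreover have "a = diff_point d (\<lambda>i. real i - 1) 1 u"
  proof
    fix i
    show "a i = diff_point d (\<lambda>i. real i - 1) 1 u i"
    proof (cases "i \<in> {1..d}")
      case True
      then show ?thesis using step[of "i - 1"] by (simp add: diff_point_def)
    next
      case False
      then have "a i = 0" using a by (simp add: R_polytope_def)
      with False show ?thesis unfolding diff_point_def by (simp only: if_False)
    qed
  qed
  ultimately show "a \<in> diff_point d (\<lambda>i. real i - 1) 1 ` lap_polytope d 1" by blast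
next
  fix a assume "a \<in> diff_point d (\<lambda>i. real i - 1) 1 ` lap_polytope d 1"
  then obtain u where u: "u \<in> lap_polytope d 1" and a: "a = diff_point d (\<lambda>i. real i - 1) 1 u" by blast
  have zero: "u 0 = 0" "u d = 0" using u by (auto simp: lap_polytope_def interior_funs_def)
  have sum: "(\<Sum>i=1..k. a i) = real (k choose 2) + u k" if "k \<le> d" for k
    using that
  proof (induction k)
    case (Suc k)
    then show ?case by (simp add: a diff_point_def choose_two_Suc)
  qed (simp add: zero)
  have "mono_on {1..d} a"
  proof (rule mono_onI)
    fix i j assume ij: "i \<in> {1..d}" "j \<in> {1..d}" "i \<le> j"
    from ij(3,2) show "a i \<le> a j"
    proof (induction j rule: dec_induct)
      case (step j)
      then have j: "j \<in> {0<..<d}" using ij by auto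
      then have "lap u j \<le> 1" using u by (simp add: lap_polytope_def)
      then have "a j \<le> a (Suc j)" using j by (simp add: a diff_point_def lap_def)
      with step show ?case using j by auto
    qed simp
  qed
  moreover have "a i = 0" if "i \<notin> {1..d}" for i
    using that unfolding a diff_point_def by (simp only: if_False)
  moreover have "real (k choose 2) \<le> (\<Sum>i=1..k. a i)" if "1 \<le> k" "k < d" for k
    using sum[of k] that u by (simp add: lap_polytope_def)
  moreover have "(\<Sum>i=1..d. a i) = real (d choose 2)" using sum[of d] zero by simp
  ultimately show "a \<in> R_polytope d"
    unfolding R_polytope_def mem_Collect_eq by blast
qed

section \<open>Leading coefficients\<close>

text \<open>\<open>Q\<close> is a unit, so the quotient condition is equivalent to a product
  condition, and polynomials embed injectively into power series. This settles both definite
  descriptions.\<close>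

lemma numerator_THE:
  fixes E Q :: "real fps"
  assumes Q: "fps_nth Q 0 \<noteq> 0" and h: "Q * E = fps_of_poly h"
  shows "(THE h. E = fps_of_poly h / Q) = h" and "E = fps_of_poly h / Q"
proof -
  have iff: "E = fps_of_poly p / Q \<longleftrightarrow> Q * E = fps_of_poly p" for p
  proof -
    have QQ: "Q * inverse Q = 1" using Q by (rule inverse_mult_eq_1')
    have div: "fps_of_poly p / Q = fps_of_poly p * inverse Q"
      using Q by (simp add: fps_divide_unit)
    show ?thesis
    proof
      assume "E = fps_of_poly p / Q"
      then have "Q * E = fps_of_poly p * (Q * inverse Q)" by (simp add: div mult_ac)
      then show "Q * E = fps_of_poly p" by (simp add: QQ)
    next
      assume p: "Q * E = fps_of_poly p"
      have "E = (Q * inverse Q) * E" by (simp add: QQ)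
      also have "\<dots> = (Q * E) * inverse Q" by (simp only: mult_ac)
      finally show "E = fps_of_poly p / Q" by (simp only: p div)
    qed
  qed
  show "E = fps_of_poly h / Q" using h iff by blast
  show "(THE h. E = fps_of_poly h / Q) = h"
    unfolding iff h by (rule the_equality) (auto simp: fps_of_poly_eq_iff)
qed

lemma signed_count_const:
  assumes "0 \<le> c"
  shows "signed_count 0 d (\<lambda>_. c) = int (card (lap_polytope d c))"
  using assms by (simp add: signed_count_nonneg lap_polytope_def)

lemma finite_lap_polytope: "finite (lap_polytope d (c :: int))"
  by (rule finite_subset[OF _ finite_ssupp[of 0 d "\<lambda>_. c"]])
    (auto simp: lap_polytope_def ssupp_def sterm_nonzero_iff)

lemma ehrhart_series_P:
  "ehrhart_series (P_132_213 d) = Abs_fps (\<lambda>m. real_of_int (signed_count 0 d (\<lambda>_. 2 * int m)))"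
proof -
  have P: "P_132_213 d = diff_point d (\<lambda>i. of_int (int d + 1 - int i)) (of_int (- 1)) `
      lap_polytope d (of_int 2)"
    by (simp add: P_132_213_eq)
  show ?thesis
    unfolding ehrhart_series_def P
    by (subst card_lattice_points_diff_point) (simp_all add: signed_count_const mult.commute)
qed

lemma ehrhart_series_R:
  "ehrhart_series (R_polytope d) = Abs_fps (\<lambda>m. real_of_int (signed_count 0 d (\<lambda>_. int m)))"
proof -
  have R: "R_polytope d = diff_point d (\<lambda>i. of_int (int i - 1)) (of_int 1) `
      lap_polytope d (of_int 1)"
    by (simp add: R_polytope_eq)
  show ?thesis
    unfolding ehrhart_series_def R
    by (subst card_lattice_points_diff_point) (simp_all add: signed_count_const)
qed

lemma signed_count_minus_two:
  assumes "1 \<le> d"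
  shows "signed_count 0 d (\<lambda>_. - 2) = (- 1) ^ (d - 1) * int (card (strong_score_sequences d))"
proof -
  have "(lap u k < - (- 2)) = (lap u k \<le> 1)" for u :: "nat \<Rightarrow> int" and k by auto
  then show ?thesis
    unfolding card_strong_score_sequences[OF assms] by (subst signed_count_neg) simp_all
qed

text \<open>Over the integers \<open>lap u k < 1\<close> means \<open>lap u k \<le> 0\<close>, which
  by \<open>lap_polytope_zero\<close> leaves only the zero function; this contradicts positivity at
  the interior point 1.\<close>

lemma signed_count_minus_one:
  assumes "2 \<le> d"
  shows "signed_count 0 d (\<lambda>_. - 1) = 0"
proof -
  have "False" if u: "u \<in> interior_funs 0 d" "\<forall>k\<in>{0<..<d}. 0 < u k \<and> lap u k < - (- 1)"
    for u :: "nat \<Rightarrow> int"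
  proof -
    have "u \<in> lap_polytope d 0" using u by (auto simp: lap_polytope_def)
    then have "u 1 = 0" by (rule lap_polytope_zero)
    moreover have "0 < u 1" using u(2) assms by auto
    ultimately show False by simp
  qed
  then have empty: "{u \<in> interior_funs 0 d. \<forall>k\<in>{0<..<d}. 0 < u k \<and> lap u k < - (- 1 :: int)} = {}"
    by blast
  show ?thesis by (subst signed_count_neg) (simp_all only: empty, simp_all)
qed

text \<open>\<open>b - 2\<close> is the right-hand side at m = -1. The choices 0 and 1 for
  \<open>b\<close> give the even and the odd dilates of R_d; 0 also gives all dilates of
  P_d.\<close>

lemma signed_count_numerator:
  assumes "1 \<le> d"
  obtains h :: "real poly" where "degree h \<le> d - 1"
    "coeff h (d - 1) = (- 1) ^ (d - 1) * real_of_int (signed_count 0 d (\<lambda>_. b - 2))"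
    "(1 - fps_X) ^ d * Abs_fps (\<lambda>m. real_of_int (signed_count 0 d (\<lambda>_. b + 2 * int m))) = fps_of_poly h"
proof -
  obtain n where d: "d = Suc n" using assms by (cases d) auto
  have "vanishing_diff (Suc n) (\<lambda>m. signed_count 0 d (\<lambda>_. b + 2 * m))"
    using vanishing_diff_signed_count[of 0 d "\<lambda>_. b"] d by simp
  then obtain h :: "real poly" where "degree h \<le> n"
    "coeff h n = (- 1) ^ n * real_of_int (signed_count 0 d (\<lambda>_. b + 2 * (- 1)))"
    "(1 - fps_X) ^ Suc n * Abs_fps (\<lambda>m. real_of_int (signed_count 0 d (\<lambda>_. b + 2 * int m))) = fps_of_poly h"
    by (rule fps_mult_vanishing_diff)
  then show ?thesis using that[of h] d by simp
qed

lemma H_poly: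
  assumes "1 \<le> d"
  shows "ehrhart_series (P_132_213 d) = fps_of_poly (H_poly d) / (1 - fps_X) ^ d"
    and "coeff (H_poly d) (d - 1) = real (card (strong_score_sequences d))"
proof -
  obtain h :: "real poly" where h:
    "coeff h (d - 1) = (- 1) ^ (d - 1) * real_of_int (signed_count 0 d (\<lambda>_. 0 - 2))"
    "(1 - fps_X) ^ d * Abs_fps (\<lambda>m. real_of_int (signed_count 0 d (\<lambda>_. 0 + 2 * int m))) = fps_of_poly h"
    by (rule signed_count_numerator[OF assms]) blast
  have prod: "(1 - fps_X) ^ d * ehrhart_series (P_132_213 d) = fps_of_poly h"
    using h(2) by (simp add: ehrhart_series_P)
  have nz: "fps_nth ((1 - fps_X :: real fps) ^ d) 0 \<noteq> 0" by (simp add: fps_nth_power_0)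
  have "H_poly d = h" "ehrhart_series (P_132_213 d) = fps_of_poly h / (1 - fps_X) ^ d"
    unfolding H_poly_def using numerator_THE[OF nz prod] by blast+
  moreover have "coeff h (d - 1) = real (card (strong_score_sequences d))"
    unfolding h(1) using signed_count_minus_two[OF assms] by (simp flip: power_mult_distrib)
  ultimately show "ehrhart_series (P_132_213 d) = fps_of_poly (H_poly d) / (1 - fps_X) ^ d"
    "coeff (H_poly d) (d - 1) = real (card (strong_score_sequences d))" by simp_all
qed

text \<open>Splitting the series by the parity of the dilation factor shows that the numerator is
  h0(t^2) + t h1(t^2), with each half coming from one polynomial count.\<close>

lemma hstar_R:
  assumes "1 \<le> d"
  obtains h0 h1 :: "real poly" where
    "ehrhart_series (R_polytope d) = fps_of_poly (hstar_R d) / (1 - fps_X ^ 2) ^ d"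
    "\<And>k. coeff (hstar_R d) (2 * k) = coeff h0 k" "\<And>k. coeff (hstar_R d) (2 * k + 1) = coeff h1 k"
    "degree h0 \<le> d - 1" "degree h1 \<le> d - 1"
    "coeff h0 (d - 1) = real (card (strong_score_sequences d))"
    "coeff h1 (d - 1) = (- 1) ^ (d - 1) * real_of_int (signed_count 0 d (\<lambda>_. - 1))"
    "coeff h0 0 = real_of_int (signed_count 0 d (\<lambda>_. 0))"
    "coeff h1 0 = real_of_int (signed_count 0 d (\<lambda>_. 1))"
proof -
  define G where "G b = Abs_fps (\<lambda>m. real_of_int (signed_count 0 d (\<lambda>_. b + 2 * int m)))" for b
  obtain h0 :: "real poly" where h0: "degree h0 \<le> d - 1"
    "coeff h0 (d - 1) = (- 1) ^ (d - 1) * real_of_int (signed_count 0 d (\<lambda>_. 0 - 2))"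
    "(1 - fps_X) ^ d * G 0 = fps_of_poly h0"
    unfolding G_def by (rule signed_count_numerator[OF assms])
  obtain h1 :: "real poly" where h1: "degree h1 \<le> d - 1"
    "coeff h1 (d - 1) = (- 1) ^ (d - 1) * real_of_int (signed_count 0 d (\<lambda>_. 1 - 2))"
    "(1 - fps_X) ^ d * G 1 = fps_of_poly h1"
    unfolding G_def by (rule signed_count_numerator[OF assms])
  define q where "q p = pcompose p (monom 1 2 :: real poly)" for p
  have q: "fps_of_poly (q p) = fps_of_poly p oo fps_X ^ 2" for p
    by (simp add: q_def fps_of_poly_pcompose fps_of_poly_monom)
  have coeff_q: "coeff (q p) k = (if even k then coeff p (k div 2) else 0)" for p k
    using arg_cong[OF q, of "\<lambda>f. fps_nth f k"] by (simp add: fps_nth_compose_X_power)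
  define h where "h = q h0 + pCons 0 (q h1)"
  have E: "ehrhart_series (R_polytope d) = (G 0 oo fps_X ^ 2) + fps_X * (G 1 oo fps_X ^ 2)"
  proof (rule fps_ext)
    fix m
    have "2 * int (m div 2) = int m" if "even m" using that by (auto elim: evenE)
    moreover have "2 * int ((m - 1) div 2) = int m - 1" if "odd m" using that by (auto elim: oddE)
    ultimately show "fps_nth (ehrhart_series (R_polytope d)) m =
        fps_nth ((G 0 oo fps_X ^ 2) + fps_X * (G 1 oo fps_X ^ 2)) m"
      by (auto simp: ehrhart_series_R G_def fps_nth_compose_X_power)
  qed
  have "(1 - fps_X :: real fps) oo fps_X ^ 2 = 1 - fps_X ^ 2"
    by (simp add: fps_compose_sub_distrib)
  then have comp: "(1 - fps_X ^ 2) ^ d * (G b oo fps_X ^ 2) = ((1 - fps_X) ^ d * G b) oo fps_X ^ 2" for b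
    by (simp add: fps_compose_mult_distrib flip: fps_compose_power)
  have "(1 - fps_X ^ 2) ^ d * ehrhart_series (R_polytope d) =
      fps_of_poly (q h0) + fps_X * fps_of_poly (q h1)"
    unfolding E distrib_left mult.left_commute[of _ fps_X] comp h0(3) h1(3) q ..
  then have prod: "(1 - fps_X ^ 2) ^ d * ehrhart_series (R_polytope d) = fps_of_poly h"
    by (simp add: h_def fps_of_poly_add fps_of_poly_pCons mult.commute)
  have nz: "fps_nth ((1 - fps_X ^ 2 :: real fps) ^ d) 0 \<noteq> 0" by (simp add: fps_nth_power_0)
  have hstar: "hstar_R d = h"
    "ehrhart_series (R_polytope d) = fps_of_poly h / (1 - fps_X ^ 2) ^ d"
    unfolding hstar_R_def using numerator_THE[OF nz prod] by blast+
  have even: "coeff h (2 * k) = coeff h0 k" for k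
    by (auto simp: h_def coeff_pCons coeff_q split: nat.split) presburger
  have odd: "coeff h (2 * k + 1) = coeff h1 k" for k
    by (simp add: h_def coeff_q)
  have const: "coeff p 0 = real_of_int (signed_count 0 d (\<lambda>_. b))"
    if "(1 - fps_X) ^ d * G b = fps_of_poly p" for p b
    using arg_cong[OF that, of "\<lambda>f. fps_nth f 0"] by (simp add: G_def fps_nth_power_0)
  show ?thesis
  proof (rule that[of h0 h1])
    show "coeff h0 (d - 1) = real (card (strong_score_sequences d))"
      unfolding h0(2) using signed_count_minus_two[OF assms] by (simp flip: power_mult_distrib)
  qed (use hstar even odd h0(1) h1(1,2) const[OF h0(3)] const[OF h1(3)] in simp_all)
qed

lemma lead_coeff_eqI:
  assumes "coeff p n = c" "c \<noteq> 0" "\<And>k. n < k \<Longrightarrow> coeff p k = 0"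
  shows "lead_coeff p = c"
proof -
  have "degree p = n"
    using assms by (intro antisym degree_le le_degree) auto
  then show ?thesis using assms(1) by simp
qed

lemma card_strong_score_sequences_pos:
  assumes "3 \<le> d"
  shows "0 < card (strong_score_sequences d)"
proof -
  let ?S = "{u \<in> interior_funs 0 d. \<forall>k\<in>{0<..<d}. 0 < u k \<and> lap u k \<le> (1 :: int)}"
  have "?S \<subseteq> lap_polytope d 1" by (auto simp: lap_polytope_def)
  then have fin: "finite ?S" using finite_lap_polytope by (rule finite_subset)
  \<comment> \<open>The constant excess 1 has \<open>lap\<close> equal to 1 next to either end and 0
    in between. With a single interior point, as for two vertices, it would be 2.\<close>
  define v :: "nat \<Rightarrow> int" where "v k = of_bool (k \<in> {0<..<d})" for k
  have "v \<in> ?S"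
    using assms by (auto simp: v_def interior_funs_def lap_def)
  then show ?thesis using fin assms by (subst card_strong_score_sequences) (auto simp: card_gt_0_iff)
qed

text \<open>The degree is \<open>2 * (d - 1)\<close>: only the top coefficient of the odd part could
  lie above, and it vanishes by \<open>signed_count_minus_one\<close>. Positivity of the number of
  sequences excludes a smaller degree.\<close>

lemma lead_coeff_hstar_R:
  assumes "3 \<le> d"
  shows "lead_coeff (hstar_R d) = real (card (strong_score_sequences d))"
proof -
  obtain h0 h1 :: "real poly" where h:
    "\<And>k. coeff (hstar_R d) (2 * k) = coeff h0 k" "\<And>k. coeff (hstar_R d) (2 * k + 1) = coeff h1 k"
    "degree h0 \<le> d - 1" "degree h1 \<le> d - 1"
    "coeff h0 (d - 1) = real (card (strong_score_sequences d))"
    "coeff h1 (d - 1) = (- 1) ^ (d - 1) * real_of_int (signed_count 0 d (\<lambda>_. - 1))"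
    by (rule hstar_R[of d]) (use assms in auto)
  have h1z: "coeff h1 k = 0" if "d - 1 \<le> k" for k
    using that h(4,6) signed_count_minus_one[of d] assms
    by (cases "k = d - 1") (auto intro: coeff_eq_0)
  show ?thesis
  proof (rule lead_coeff_eqI[of _ "2 * (d - 1)"])
    fix k assume k: "2 * (d - 1) < k"
    show "coeff (hstar_R d) k = 0"
    proof (cases "even k")
      case True
      then obtain j where "k = 2 * j" by (rule evenE)
      then show ?thesis using h(1)[of j] h(3) k by (simp add: coeff_eq_0)
    next
      case False
      then obtain j where "k = 2 * j + 1" by (rule oddE)
      then show ?thesis using h(2)[of j] h1z[of j] k by simp
    qed
  qed (use h(1)[of "d - 1"] h(5) card_strong_score_sequences_pos[OF assms] in auto)
qed

section \<open>Dimensions one and two\<close>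

lemma poly_eq_pairI:
  fixes p :: "real poly"
  assumes "coeff p 0 = a" "coeff p 1 = b" "\<And>k. 1 \<le> k \<Longrightarrow> coeff p (2 * k) = 0"
    "\<And>k. 1 \<le> k \<Longrightarrow> coeff p (2 * k + 1) = 0"
  shows "p = [:a, b:]"
proof (rule poly_eqI)
  fix k
  show "coeff p k = coeff [:a, b:] k"
  proof (cases "k < 2")
    case True
    then show ?thesis using assms(1,2) by (auto simp: less_2_cases_iff)
  next
    case False
    have "coeff [:a, b:] k = 0" using False by (intro coeff_eq_0) simp
    moreover have "coeff p k = 0"
    proof (cases "even k")
      case True
      then show ?thesis using assms(3)[of "k div 2"] False by simp
    next
      case odd: False
      then show ?thesis using assms(4)[of "k div 2"] False by simp
    qed
    ultimately show ?thesis by simp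
  qed
qed

text \<open>Without interior points the count is 1 for every right-hand side, negative ones
  included, so the odd part survives and contributes the leading term.\<close>

lemma hstar_R_1: "hstar_R 1 = [:1, 1:]"
proof -
  obtain h0 h1 :: "real poly" where h:
    "\<And>k. coeff (hstar_R 1) (2 * k) = coeff h0 k" "\<And>k. coeff (hstar_R 1) (2 * k + 1) = coeff h1 k"
    "degree h0 \<le> 1 - 1" "degree h1 \<le> 1 - 1"
    "coeff h0 0 = real_of_int (signed_count 0 1 (\<lambda>_. 0))"
    "coeff h1 0 = real_of_int (signed_count 0 1 (\<lambda>_. 1))"
    by (rule hstar_R[of 1]) auto
  have "signed_count 0 1 b = 1" for b using signed_count_empty[of 0] by simp
  then show ?thesis
    using h h(1)[of 0] h(2)[of 0] by (intro poly_eq_pairI) (simp_all add: coeff_eq_0)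
qed

text \<open>The only free value satisfies \<open>2 * u 1 \<le> c\<close>, and \<open>c\<close> is
  below 2.\<close>

lemma lap_polytope_2:
  assumes "0 \<le> c" "c < 2"
  shows "lap_polytope 2 (c :: int) = {\<lambda>_. 0}"
proof -
  have "u k = 0" if u: "u \<in> lap_polytope 2 c" for u k
  proof (cases "k = 1")
    case True
    have "u 0 = 0" "u 2 = 0" "0 \<le> u 1" "lap u 1 \<le> c"
      using u by (auto simp: lap_polytope_def interior_funs_def)
    then show ?thesis using True assms by (simp add: lap_def numeral_2_eq_2)
  next
    case False
    then have "k \<notin> {0<..<2}" by auto
    then show ?thesis using u unfolding lap_polytope_def interior_funs_def by blast
  qed
  moreover have "(\<lambda>_. 0) \<in> lap_polytope 2 c"
    using assms by (simp add: lap_polytope_def interior_funs_def lap_def)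
  ultimately show ?thesis by blast
qed

text \<open>Strength would force a positive outdegree at both vertices, but there is only one
  arc.\<close>

lemma no_strong_tournament_2:
  assumes T: "tournament V T" and V: "card V = 2"
  shows "\<not> strong_tournament V T"
proof
  assume "strong_tournament V T"
  then have cut: "card A choose 2 < (\<Sum>v\<in>A. outdeg V T v)" if "A \<subset> V" "A \<noteq> {}" for A
    using that strong_tournament_iff[OF T] by simp
  obtain a b where ab: "V = {a, b}" "a \<noteq> b" using V by (auto simp: card_2_iff)
  have "0 < outdeg V T a" "0 < outdeg V T b"
    using cut[of "{a}"] cut[of "{b}"] ab by (force simp: binomial_eq_0)+
  moreover have "outdeg V T a + outdeg V T b = 1"
    using tournament_outdeg_sum[OF T] ab V by (simp add: numeral_2_eq_2)
  ultimately show False by simp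
qed

text \<open>Both top coefficients vanish, the even one because there is no strong tournament, so
  only the constant terms of the two parts remain.\<close>

lemma hstar_R_2: "hstar_R 2 = [:1, 1:]"
proof -
  obtain h0 h1 :: "real poly" where h:
    "\<And>k. coeff (hstar_R 2) (2 * k) = coeff h0 k" "\<And>k. coeff (hstar_R 2) (2 * k + 1) = coeff h1 k"
    "degree h0 \<le> 2 - 1" "degree h1 \<le> 2 - 1"
    "coeff h0 (2 - 1) = real (card (strong_score_sequences 2))"
    "coeff h1 (2 - 1) = (- 1) ^ (2 - 1) * real_of_int (signed_count 0 2 (\<lambda>_. - 1))"
    "coeff h0 0 = real_of_int (signed_count 0 2 (\<lambda>_. 0))"
    "coeff h1 0 = real_of_int (signed_count 0 2 (\<lambda>_. 1))"
    by (rule hstar_R[of 2]) auto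
  have "signed_count 0 2 (\<lambda>_. 0) = 1" "signed_count 0 2 (\<lambda>_. 1) = 1"
    by (simp_all add: signed_count_const lap_polytope_2)
  moreover have "\<not> strong_tournament {1..2 :: nat} T" for T
  proof
    assume T: "strong_tournament {1..2 :: nat} T"
    then have "tournament {1..2} T" by (simp add: strong_tournament_def)
    from no_strong_tournament_2[OF this] T show False by simp
  qed
  then have "strong_score_sequences 2 = {}" by (simp add: strong_score_sequences_def)
  moreover have "coeff h0 k = 0 \<and> coeff h1 k = 0" if "1 \<le> k" for k
    using that h(3-6) \<open>strong_score_sequences 2 = {}\<close> signed_count_minus_one[of 2]
    by (cases "k = 1") (auto simp: coeff_eq_0)
  ultimately show ?thesis
    using h(1,2,7,8) h(1)[of 0] h(2)[of 0] by (intro poly_eq_pairI) simp_all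
qed

theorem theorem1p2:
  shows "(\<forall>d\<ge>3.
            ehrhart_series (P_132_213 d) = fps_of_poly (H_poly d) / (1 - fps_X) ^ d \<and>
            coeff (H_poly d) (d - 1) = real (card (strong_score_sequences d)))
       \<and> (\<forall>d. d = 1 \<or> d \<ge> 3 \<longrightarrow>
            ehrhart_series (R_polytope d) = fps_of_poly (hstar_R d) / (1 - fps_X ^ 2) ^ d \<and>
            lead_coeff (hstar_R d) = real (card (strong_score_sequences d)))
       \<and> ehrhart_series (R_polytope 2) = fps_of_poly (hstar_R 2) / (1 - fps_X ^ 2) ^ 2
       \<and> hstar_R 2 = [:1, 1:]
       \<and> (\<forall>(V :: 'v set) T. card V = 2 \<and> tournament V T \<longrightarrow> \<not> strong_tournament V T)"
proof -
  have R: "ehrhart_series (R_polytope d) = fps_of_poly (hstar_R d) / (1 - fps_X ^ 2) ^ d"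
    if "1 \<le> d" for d
    by (rule hstar_R[OF that])
  \<comment> \<open>The number of one-vertex sequences is read off from the signed count over an
    empty set of constraints.\<close>
  have "card (strong_score_sequences 1) = 1"
    using signed_count_minus_two[of 1] signed_count_empty[of 0 "\<lambda>_. - 2"] by simp
  then have "lead_coeff (hstar_R d) = real (card (strong_score_sequences d))"
    if "d = 1 \<or> d \<ge> 3" for d
    using that hstar_R_1 lead_coeff_hstar_R[of d] by auto
  moreover have "\<forall>(V :: 'v set) T. card V = 2 \<and> tournament V T \<longrightarrow> \<not> strong_tournament V T"
    using no_strong_tournament_2 by blast
  ultimately show ?thesis
    using H_poly R hstar_R_2 by simp
qed

end
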